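(* Let $N\in\mathbb{Z}_{\ge0}$, let $k=(k_1,k_2)$ with $k_1,k_2\ge0$, and put $\alpha=k_1+k_2-\frac12$, $\beta=k_2-\frac12$. Then $$\mathcal{M}(N,k)(x)=\frac{2^{2N-1}N!}{(N+\alpha+\beta+2)_N}\begin{pmatrix}P_N^{(\alpha+1,\beta)}(x)+P_N^{(\alpha,\beta+1)}(x)&-P_N^{(\alpha+1,\beta)}(x)+P_N^{(\alpha,\beta+1)}(x)\\-P_N^{(\alpha+1,\beta)}(x)+P_N^{(\alpha,\beta+1)}(x)&P_N^{(\alpha+1,\beta)}(x)+P_N^{(\alpha,\beta+1)}(x)\end{pmatrix}\begin{pmatrix}1&\frac{\alpha-\beta}{2N+\alpha+\beta+2}\\0&1\end{pmatrix}.$$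
   Context: Pochhammer symbol: $(a)_0=1$, $(a)_N=a(a+1)\cdots(a+N-1)$. Classical Jacobi polynomials: $P_n^{(\alpha,\beta)}(x)=\frac{(\alpha+1)_n}{n!}\,{}_2F_1\left(-n,\,n+\alpha+\beta+1;\,\alpha+1;\,\frac{1-x}{2}\right)$. Non-symmetric Jacobi polynomials of type $BC_1$: for $k=(k_1,k_2)$ with real $k_1,k_2\ge0$ put $\delta_k(z)=\left(1-\frac{z+z^{-1}}{2}\right)^{k_1}\left(1-\frac{z^2+z^{-2}}{2}\right)^{k_2}$ and, on $\mathbb{C}[z^{\pm1}]$, the inner product $(p,q)_k=\int_{S^1}\overline{p(z)}q(z)\delta_k(z)\frac{dz}{iz}$. Order the monomials by $1<z<z^{-1}<z^2<z^{-2}<z^3<\cdots$. For $n\in\mathbb{Z}$, $E(n,k)\in\mathbb{C}[z^{\pm1}]$ is the unique Laurent polynomial with $E(n,k)=z^n+$ (linear combination of monomials smaller than $z^n$) and $(E(n,k),z^j)_k=0$ for all monomials $z^j<z^n$. Put $P(n,k)(z)=(E(n,k)(z),E(n,k)(z^{-1}))^T$. With $\Psi(z)=\begin{pmatrix}1&z\\1&z^{-1}\end{pmatrix}$, let $\mathcal{P}(n,k)\in\mathbb{C}[x]\otimes\mathbb{C}^2$ be the vector-valued polynomial determined by $\mathcal{P}(n,k)\left(\frac{z+z^{-1}}{2}\right)=\Psi(z)^{-1}P(n,k)(z)$ (equivalently, $\mathcal{P}(n,k)=(f_1,f_2)^T$ where $f_1,f_2$ are the unique polynomials with $E(n,k)(z)=f_1(\frac{z+z^{-1}}2)+zf_2(\frac{z+z^{-1}}2)$).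 For $N\in\mathbb{Z}_{\ge0}$, $\mathcal{M}(N,k)$ is the $2\times2$-matrix-valued polynomial in $x$ with first column $\mathcal{P}(-N,k)$ and second column $\mathcal{P}(N+1,k)$. *)

theory Defs
  imports
    "HOL-Complex_Analysis.Complex_Analysis"
    "HOL-Library.Poly_Mapping"
begin

text \<open>
  Laurent polynomials with complex coefficients are the monoid algebra over the additive group of
  the integers: \<open>Poly_Mapping.lookup p j\<close> is the coefficient of \<open>z\<^sup>j\<close>, and
  \<open>Poly_Mapping.single j 1\<close> is the monomial \<open>z\<^sup>j\<close>.
\<close>

type_synonym laurent_poly = "int \<Rightarrow>\<^sub>0 complex"

abbreviation monomial :: "int \<Rightarrow> laurent_poly" where
  "monomial j \<equiv> Poly_Mapping.single j 1"

definition laurent_eval :: "laurent_poly \<Rightarrow> complex \<Rightarrow> complex" where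
  "laurent_eval p z = (\<Sum>j\<in>Poly_Mapping.keys p. Poly_Mapping.lookup p j * z powi j)"

text \<open>
  On the unit circle both bases below are nonnegative reals, so the principal branch of the complex
  power is the ordinary real power. The convention \<open>0 powr 0 = 0\<close> only affects the values at
  \<open>z = 1\<close> and \<open>z = -1\<close>, hence no integral over the circle.
\<close>

definition weight :: "real \<times> real \<Rightarrow> complex \<Rightarrow> complex" where
  "weight k z = (1 - (z + inverse z) / 2) powr of_real (fst k)
              * (1 - (z\<^sup>2 + inverse (z\<^sup>2)) / 2) powr of_real (snd k)"

definition laurent_inner :: "real \<times> real \<Rightarrow> laurent_poly \<Rightarrow> laurent_poly \<Rightarrow> complex" where
  "laurent_inner k p q =
     contour_integral (circlepath 0 1)
       (\<lambda>z. cnj (laurent_eval p z) * laurent_eval q z * weight k z / (\<i> * z))"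

text \<open>
  The position of \<open>z\<^sup>n\<close> in the enumeration
  \<open>1 < z < z\<^sup>-\<^sup>1 < z\<^sup>2 < z\<^sup>-\<^sup>2 < \<dots>\<close>.
\<close>

definition monomial_rank :: "int \<Rightarrow> int" where
  "monomial_rank n = (if n > 0 then 2 * n - 1 else - 2 * n)"

definition monomial_less :: "int \<Rightarrow> int \<Rightarrow> bool" where
  "monomial_less j n \<longleftrightarrow> monomial_rank j < monomial_rank n"

definition nonsym_jacobi :: "int \<Rightarrow> real \<times> real \<Rightarrow> laurent_poly" where
  "nonsym_jacobi n k = (THE E.
     Poly_Mapping.keys (E - monomial n) \<subseteq> {j. monomial_less j n} \<and>
     (\<forall>j. monomial_less j n \<longrightarrow> laurent_inner k E (monomial j) = 0))"

definition nonsym_jacobi_vec :: "int \<Rightarrow> real \<times> real \<Rightarrow> complex \<Rightarrow> complex^2" where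
  "nonsym_jacobi_vec n k z =
     vector [laurent_eval (nonsym_jacobi n k) z, laurent_eval (nonsym_jacobi n k) (inverse z)]"

definition Psi :: "complex \<Rightarrow> complex^2^2" where
  "Psi z = vector [vector [1, z], vector [1, inverse z]]"

text \<open>The matrix \<open>Psi z\<close> is invertible exactly if \<open>z\<close> is not \<open>0\<close>, \<open>1\<close> or \<open>-1\<close>.\<close>

definition vv_jacobi :: "int \<Rightarrow> real \<times> real \<Rightarrow> complex poly^2" where
  "vv_jacobi n k = (THE F.
     \<forall>z. z \<noteq> 0 \<and> z\<^sup>2 \<noteq> 1 \<longrightarrow>
       (\<chi> i. poly (F $ i) ((z + inverse z) / 2)) = matrix_inv (Psi z) *v nonsym_jacobi_vec n k z)"

definition mv_jacobi :: "nat \<Rightarrow> real \<times> real \<Rightarrow> complex poly^2^2" where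
  "mv_jacobi N k = (\<chi> i j. (if j = 1 then vv_jacobi (- int N) k else vv_jacobi (int N + 1) k) $ i)"

definition poly_matrix_eval :: "complex poly^2^2 \<Rightarrow> complex \<Rightarrow> complex^2^2" where
  "poly_matrix_eval M x = (\<chi> i j. poly (M $ i $ j) x)"

definition hypergeometric_2F1 :: "complex \<Rightarrow> complex \<Rightarrow> complex \<Rightarrow> complex \<Rightarrow> complex" where
  "hypergeometric_2F1 a b c z = eval_fps (fps_hypergeo [a, b] [c] 1) z"

definition jacobi_P :: "nat \<Rightarrow> real \<Rightarrow> real \<Rightarrow> complex \<Rightarrow> complex" where
  "jacobi_P n \<alpha> \<beta> x =
     of_real (pochhammer (\<alpha> + 1) n / fact n)
     * hypergeometric_2F1 (- of_nat n) (of_real (real n + \<alpha> + \<beta> + 1)) (of_real (\<alpha> + 1)) ((1 - x) / 2)"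

end

theory Submission
  imports Defs
begin

text \<open>
  Every Laurent polynomial is \<open>(1 - z) u(x) + (1 + z) v(x)\<close> with \<open>x = (z + 1/z)/2\<close>. On the unit
  circle the two summands are orthogonal, because \<open>(1 - 1/z) (1 + z) = z - 1/z\<close> is odd, and since
  \<open>\<bar>1 \<mp> z\<bar>\<^sup>2 = 2 (1 \<mp> x)\<close> they carry the Jacobi weights with parameters
  \<open>(\<alpha> + 1, \<beta>)\<close> and \<open>(\<alpha>, \<beta> + 1)\<close>. The monomials below \<open>z\<^sup>-\<^sup>N\<close> span the space where \<open>u\<close> and
  \<open>v\<close> have degree less than \<open>N\<close>, so \<open>E(-N)\<close> and \<open>E(N + 1)\<close> are combinations of
  \<open>(1 - z) P\<^sub>N\<close> and \<open>(1 + z) Q\<^sub>N\<close>, where \<open>P\<^sub>N\<close> and \<open>Q\<^sub>N\<close> are the Jacobi polynomials of these parameters.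
  Orthogonality of \<open>E(N + 1)\<close> to \<open>z\<^sup>-\<^sup>N\<close> is a condition on the ratio of the norms of these two.

  Orthogonality and the norm ratio follow from a single identity for the functional
  \<open>L p = \<integral> p w\<close>, namely \<open>L (t (1 - t) p' + (c - s t) p) = 0\<close> with \<open>t = (1 - x)/2\<close>,
  \<open>c = \<alpha> + 1\<close>, \<open>s = \<alpha> + \<beta> + 2\<close>, which is the integral of a derivative over the circle.
\<close>

section \<open>Linear functionals of Jacobi type\<close>

text \<open>The Gauss operator \<open>t (1 - t) p'' + (c - s t) p'\<close>. The series 2F1(a, b; c;
  t) with a + b + 1 = s is an eigenfunction for the eigenvalue a b.\<close>

definition hypergeo_op :: "'a::field_char_0 \<Rightarrow> 'a \<Rightarrow> 'a poly \<Rightarrow> 'a poly" where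
  "hypergeo_op c s p = [:0, 1, -1:] * pderiv (pderiv p) + [:c, -s:] * pderiv p"

lemma coeff_hypergeo_op:
  "coeff (hypergeo_op c s p) i
     = of_nat (Suc i) * (of_nat i + c) * coeff p (Suc i) - of_nat i * (of_nat i + s - 1) * coeff p i"
proof (cases i)
  case 0
  then show ?thesis by (simp add: hypergeo_op_def coeff_pderiv)
next
  case (Suc j)
  show ?thesis
  proof (cases j)
    case 0
    then show ?thesis using Suc by (simp add: hypergeo_op_def coeff_pderiv algebra_simps)
  next
    case (Suc m)
    then show ?thesis using \<open>i = Suc j\<close>
      by (simp add: hypergeo_op_def coeff_pderiv coeff_pCons algebra_simps)
  qed
qed

text \<open>The model is integration against t^(c-1) (1-t)^(s-c-1) over [0, 1], where
  \<open>pearson\<close> integrates the derivative of t^c (1-t)^(s-c) p. The class is closed under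
  multiplying the weight by t or by 1 - t, so one argument serves both Jacobi families.\<close>

locale jacobi_functional =
  fixes L :: "'a::field_char_0 poly \<Rightarrow> 'a" and c s :: 'a
  assumes add: "L (p + q) = L p + L q"
    and smult: "L (Polynomial.smult a p) = a * L p"
    and pearson: "L ([:0, 1, -1:] * pderiv p + [:c, -s:] * p) = 0"
begin

lemma zero [simp]: "L 0 = 0"
  using smult[of 0 0] by simp

lemma minus: "L (- p) = - L p"
  using smult[of "-1" p] by simp

lemma diff: "L (p - q) = L p - L q"
  using add[of p "- q"] minus[of q] by simp

text \<open>The exponent of t in the model weight grows by one, so both \<open>c\<close> and
  \<open>s\<close> do. The identity for \<open>p\<close> is \<open>pearson\<close> for
  \<open>t p\<close>.\<close>

lemma mult_t: "jacobi_functional (\<lambda>p. L ([:0, 1:] * p)) (c + 1) (s + 1)"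
proof
  fix p
  have "[:0, 1:] * ([:0, 1, -1:] * pderiv p + [:c + 1, -(s + 1):] * p)
      = [:0, 1, -1:] * pderiv ([:0, 1:] * p) + [:c, -s:] * ([:0, 1:] * p)"
    unfolding pderiv_mult
    by (intro poly_eq_poly_eq_iff[THEN iffD1] ext) (simp add: pderiv_pCons algebra_simps)
  then show "L ([:0, 1:] * ([:0, 1, -1:] * pderiv p + [:c + 1, -(s + 1):] * p)) = 0"
    using pearson by metis
qed (simp_all only: distrib_left add mult_smult_right smult)

text \<open>Here the exponent s - c - 1 of 1 - t grows, hence only \<open>s\<close>. The identity
  for \<open>p\<close> is \<open>pearson\<close> for \<open>(1 - t) p\<close>.\<close>

lemma mult_one_minus_t: "jacobi_functional (\<lambda>p. L ([:1, -1:] * p)) c (s + 1)"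
proof
  fix p
  have "[:1, -1:] * ([:0, 1, -1:] * pderiv p + [:c, -(s + 1):] * p)
      = [:0, 1, -1:] * pderiv ([:1, -1:] * p) + [:c, -s:] * ([:1, -1:] * p)"
    unfolding pderiv_mult
    by (intro poly_eq_poly_eq_iff[THEN iffD1] ext) (simp add: pderiv_pCons algebra_simps)
  then show "L ([:1, -1:] * ([:0, 1, -1:] * pderiv p + [:c, -(s + 1):] * p)) = 0"
    using pearson by metis
qed (simp_all only: distrib_left add mult_smult_right smult)

text \<open>The defining identity, applied to \<open>p' q\<close>.\<close>

lemma hypergeo_op_parts:
  "L (hypergeo_op c s p * q) = - L ([:0, 1, -1:] * pderiv p * pderiv q)"
proof -
  have "hypergeo_op c s p * q + [:0, 1, -1:] * pderiv p * pderiv q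
      = [:0, 1, -1:] * pderiv (pderiv p * q) + [:c, -s:] * (pderiv p * q)"
    unfolding hypergeo_op_def pderiv_mult by (simp only: algebra_simps)
  then have "L (hypergeo_op c s p * q + [:0, 1, -1:] * pderiv p * pderiv q) = 0"
    using pearson by metis
  then show ?thesis by (simp add: add eq_neg_iff_add_eq_0)
qed

text \<open>The right side of \<open>hypergeo_op_parts\<close> is symmetric in \<open>p\<close> and
  \<open>q\<close>.\<close>

lemma hypergeo_op_symmetric: "L (hypergeo_op c s p * q) = L (p * hypergeo_op c s q)"
  using hypergeo_op_parts[of p q] hypergeo_op_parts[of q p] by (simp only: mult_ac)

text \<open>The operator is symmetric, and triangular in the degree with diagonal entries
  \<open>- ?l m\<close>. Induction on a degree bound for \<open>q\<close> therefore leaves only its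
  top coefficient, where distinct eigenvalues force orthogonality.\<close>

lemma orthogonal_lower_degree:
  assumes ode: "hypergeo_op c s y = Polynomial.smult (- (of_nat n * (of_nat n + s - 1))) y"
    and s: "\<And>j. s + of_nat j \<noteq> 0"
    and q: "\<And>i. i \<ge> n \<Longrightarrow> coeff q i = 0"
  shows "L (y * q) = 0"
proof -
  let ?l = "\<lambda>m::nat. of_nat m * (of_nat m + s - 1)"
  have "L (y * q) = 0" if "m \<le> n" "\<And>i. i \<ge> m \<Longrightarrow> coeff q i = 0" for m q
    using that
  proof (induction m arbitrary: q)
    case 0
    then have "q = 0" by (intro poly_eqI) auto
    then show ?case by simp
  next
    case (Suc m)
    \<comment> \<open>Adding \<open>?l m\<close> times \<open>q\<close> kills the coefficient of
      degree \<open>m\<close>, so the induction hypothesis applies to \<open>r\<close>.\<close>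
    define r where "r = hypergeo_op c s q + Polynomial.smult (?l m) q"
    have "coeff r i = 0" if "i \<ge> m" for i
      using Suc.prems(2)[of i] Suc.prems(2)[of "Suc i"] that
      by (cases "i = m") (auto simp: r_def coeff_hypergeo_op)
    then have "L (y * r) = 0" using Suc.IH Suc.prems(1) by auto
    moreover have "L (y * r) = L (hypergeo_op c s y * q) + ?l m * L (y * q)"
      by (simp add: r_def distrib_left add smult hypergeo_op_symmetric)
    moreover have "L (hypergeo_op c s y * q) = - ?l n * L (y * q)"
      unfolding ode mult_smult_left smult ..
    moreover have "x = 0 \<Longrightarrow> x = h + a * w \<Longrightarrow> h = - b * w \<Longrightarrow> (b - a) * w = 0" for x h a b w :: 'a
      by (auto simp: algebra_simps)
    ultimately have "(?l n - ?l m) * L (y * q) = 0" by blast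
    moreover have "?l n - ?l m \<noteq> 0"
    proof -
      \<comment> \<open>The difference of the eigenvalues factors as (n - m) (s + m + n - 1), and n
        - m = d + 1.\<close>
      obtain d where d: "n = Suc (m + d)"
      using Suc.prems(1) by (metis less_iff_Suc_add Suc_le_eq)
      have "?l n - ?l m = of_nat (Suc d) * (s + of_nat (m + n - 1))"
        unfolding d by (simp add: algebra_simps)
      then show ?thesis using s by (simp only: mult_eq_0_iff of_nat_eq_0_iff) simp
    qed
    ultimately show ?case by simp
  qed
  from this[OF order_refl q] show ?thesis .
qed

text \<open>Cancelling the leading coefficients of \<open>P\<close> and \<open>u\<close> against
  each other leaves a polynomial of degree below \<open>n\<close>, to which \<open>P\<close> is
  orthogonal.\<close>

lemma orthogonal_leading_coeff:
  assumes orth: "\<And>q. (\<And>i. i \<ge> n \<Longrightarrow> coeff q i = 0) \<Longrightarrow> L (P * q) = 0"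
    and P: "\<And>i. i > n \<Longrightarrow> coeff P i = 0" and u: "\<And>i. i > n \<Longrightarrow> coeff u i = 0"
  shows "coeff P n * L (P * u) = coeff u n * L (P * P)"
proof -
  have "L (P * (Polynomial.smult (coeff P n) u - Polynomial.smult (coeff u n) P)) = 0"
    using P u by (intro orth) (simp add: le_less, auto)
  then show ?thesis by (simp add: right_diff_distrib diff smult)
qed

text \<open>As P - Q has lower degree, both norms are integrals of the same product P Q, against t
  and 1 - t. Now \<open>pearson\<close> for P Q relates these two: up to lower degree, t P' is n P
  and (1 - t) Q' is - n Q.\<close>

lemma norm_ratio:
  assumes orthP: "\<And>q. (\<And>i. i \<ge> n \<Longrightarrow> coeff q i = 0) \<Longrightarrow> L ([:0, 1:] * (P * q)) = 0"
    and orthQ: "\<And>q. (\<And>i. i \<ge> n \<Longrightarrow> coeff q i = 0) \<Longrightarrow> L ([:1, -1:] * (Q * q)) = 0"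
    and P: "\<And>i. i > n \<Longrightarrow> coeff P i = 0" and Q: "\<And>i. i > n \<Longrightarrow> coeff Q i = 0"
    and lead: "coeff P n = coeff Q n"
  shows "(of_nat n + s - c) * L ([:0, 1:] * (P * P)) = (of_nat n + c) * L ([:1, -1:] * (Q * Q))"
proof -
  let ?N = "of_nat n :: 'a"
  have "L ([:0, 1:] * (P * (P - Q))) = 0" "L ([:1, -1:] * (Q * (Q - P))) = 0"
    using P Q lead by (intro orthP orthQ; simp add: le_less, auto)+
  then have "L ([:0, 1:] * (P * P)) = L ([:0, 1:] * (P * Q))"
      "L ([:1, -1:] * (Q * Q)) = L ([:1, -1:] * (P * Q))"
    by (simp_all only: right_diff_distrib diff mult.commute[of Q P] right_minus_eq)
  then have *: "(?N + s - c) * L ([:0, 1:] * (P * P)) - (?N + c) * L ([:1, -1:] * (Q * Q))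
     = L (Polynomial.smult (?N + s - c) ([:0, 1:] * (P * Q))
          - Polynomial.smult (?N + c) ([:1, -1:] * (P * Q)))"
    by (simp only: diff smult)
  txt \<open>The leading terms cancel in \<open>t P' - n P\<close> and \<open>(1 - t) Q' + n Q\<close>.\<close>
  have c1: "coeff ([:0, 1:] * pderiv P - Polynomial.smult ?N P) i = 0" if "i \<ge> n" for i
    using that P by (cases i; cases "i = n") (auto simp: coeff_pderiv)
  have c2: "coeff ([:1, -1:] * pderiv Q + Polynomial.smult ?N Q) i = 0" if "i \<ge> n" for i
    using that Q by (cases i; cases "i = n") (auto simp: coeff_pderiv)
  have "Polynomial.smult (?N + s - c) ([:0, 1:] * (P * Q)) - Polynomial.smult (?N + c) ([:1, -1:] * (P * Q))
     = [:1, -1:] * (Q * ([:0, 1:] * pderiv P - Polynomial.smult ?N P))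
       + [:0, 1:] * (P * ([:1, -1:] * pderiv Q + Polynomial.smult ?N Q))
       - ([:0, 1, -1:] * pderiv (P * Q) + [:c, -s:] * (P * Q))"
    unfolding pderiv_mult
    by (intro poly_eq_poly_eq_iff[THEN iffD1] ext) (simp add: pderiv_pCons algebra_simps)
  then have "L (Polynomial.smult (?N + s - c) ([:0, 1:] * (P * Q)) - Polynomial.smult (?N + c) ([:1, -1:] * (P * Q))) = 0"
    using orthQ[OF c1] orthP[OF c2] pearson[of "P * Q"] by (simp only: add diff) simp
  with * show ?thesis by simp
qed

end

section \<open>Terminating hypergeometric series as polynomials\<close>

definition hypergeo_poly :: "nat \<Rightarrow> 'a::field_char_0 \<Rightarrow> 'a \<Rightarrow> 'a poly" where
  "hypergeo_poly n b c = (\<Sum>i\<le>n. Polynomial.monom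
     (pochhammer (- of_nat n) i * pochhammer b i / (pochhammer c i * fact i)) i)"

text \<open>Beyond degree \<open>n\<close> the factor \<open>pochhammer (- of_nat n) i\<close>
  vanishes, so the formula holds for every \<open>i\<close>.\<close>

lemma coeff_hypergeo_poly:
  "coeff (hypergeo_poly n b c) i
    = pochhammer (- of_nat n) i * pochhammer b i / (pochhammer c i * fact i)"
  by (auto simp: hypergeo_poly_def coeff_sum pochhammer_of_nat_eq_0_iff)

lemma hypergeo_2F1_eq_poly: "hypergeometric_2F1 (- of_nat n) b c t = poly (hypergeo_poly n b c) t"
proof -
  have "fps_hypergeo [- of_nat n, b] [c] 1 = fps_of_poly (hypergeo_poly n b c)"
    by (rule fps_ext) (simp add: coeff_hypergeo_poly)
  then show ?thesis by (simp add: hypergeometric_2F1_def)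
qed

text \<open>At each degree this is the ratio of consecutive hypergeometric coefficients, because (i
  - n)(n + s - 1 + i) = i (i + s - 1) - n (n + s - 1).\<close>

lemma hypergeo_poly_ode:
  fixes c s :: "'a::field_char_0"
  assumes c: "\<And>j. c + of_nat j \<noteq> 0"
  shows "hypergeo_op c s (hypergeo_poly n (of_nat n + s - 1) c)
     = Polynomial.smult (- (of_nat n * (of_nat n + s - 1))) (hypergeo_poly n (of_nat n + s - 1) c)"
proof (rule poly_eqI)
  fix i
  let ?h = "coeff (hypergeo_poly n (of_nat n + s - 1) c)"
  have c': "c + of_nat i \<noteq> 0" "pochhammer c i \<noteq> 0"
    using c by (auto simp: pochhammer_eq_0_iff eq_neg_iff_add_eq_0)
  have "of_nat (Suc i) * (of_nat i + c) * ?h (Suc i)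
      = (- of_nat n + of_nat i) * (of_nat n + s - 1 + of_nat i) * ?h i"
    using c' of_nat_neq_0[of i, where 'a='a] by (simp add: coeff_hypergeo_poly pochhammer_Suc divide_simps)
  then show "coeff (hypergeo_op c s (hypergeo_poly n (of_nat n + s - 1) c)) i
      = coeff (Polynomial.smult (- (of_nat n * (of_nat n + s - 1))) (hypergeo_poly n (of_nat n + s - 1) c)) i"
    unfolding coeff_hypergeo_op by (simp add: algebra_simps)
qed

section \<open>Laurent polynomials\<close>

lemma laurent_eval_superset:
  assumes "finite A" "Poly_Mapping.keys p \<subseteq> A"
  shows "laurent_eval p z = (\<Sum>j\<in>A. Poly_Mapping.lookup p j * z powi j)"
  unfolding laurent_eval_def using assms
  by (intro sum.mono_neutral_left) (auto simp: in_keys_iff)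

lemma laurent_eval_0 [simp]: "laurent_eval 0 z = 0"
  by (simp add: laurent_eval_def)

lemma laurent_eval_single [simp]: "laurent_eval (Poly_Mapping.single k v) z = v * z powi k"
  by (simp add: laurent_eval_superset[of "{k}"])

lemma laurent_eval_add [simp]: "laurent_eval (p + q) z = laurent_eval p z + laurent_eval q z"
proof -
  let ?A = "Poly_Mapping.keys p \<union> Poly_Mapping.keys q"
  have "laurent_eval r z = (\<Sum>j\<in>?A. Poly_Mapping.lookup r j * z powi j)"
    if "Poly_Mapping.keys r \<subseteq> ?A" for r
    using that by (intro laurent_eval_superset) auto
  then show ?thesis
    using Poly_Mapping.keys_add[of p q] by (simp add: lookup_add distrib_right sum.distrib)
qed

lemma laurent_eval_diff [simp]: "laurent_eval (p - q) z = laurent_eval p z - laurent_eval q z"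
  using laurent_eval_add[of "p - q" q z] by simp

lemma laurent_eval_sum: "laurent_eval (sum f A) z = (\<Sum>x\<in>A. laurent_eval (f x) z)"
  by (induction A rule: infinite_finite_induct) auto

lemma sum_single_lookup: "(\<Sum>k\<in>Poly_Mapping.keys p. Poly_Mapping.single k (Poly_Mapping.lookup p k)) = p"
  by (rule poly_mapping_eqI) (auto simp: lookup_sum lookup_single when_def in_keys_iff)

lemma lookup_single_times:
  fixes p :: "int \<Rightarrow>\<^sub>0 'a::comm_semiring_1"
  shows "Poly_Mapping.lookup (Poly_Mapping.single k v * p) m = v * Poly_Mapping.lookup p (m - k)"
proof -
  have "Poly_Mapping.single k v * p
      = (\<Sum>j\<in>Poly_Mapping.keys p. Poly_Mapping.single (k + j) (v * Poly_Mapping.lookup p j))"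
    by (subst sum_single_lookup[symmetric]) (simp add: sum_distrib_left mult_single)
  then have "Poly_Mapping.lookup (Poly_Mapping.single k v * p) m
      = (\<Sum>j\<in>Poly_Mapping.keys p. if j = m - k then v * Poly_Mapping.lookup p j else 0)"
    by (simp only: lookup_sum lookup_single when_def) (intro sum.cong; auto)
  also have "\<dots> = v * Poly_Mapping.lookup p (m - k)"
    by (simp only: sum.delta[OF finite_keys]) (simp add: in_keys_iff)
  finally show ?thesis .
qed

lemma laurent_eval_single_times:
  assumes "z \<noteq> 0"
  shows "laurent_eval (Poly_Mapping.single k v * p) z = v * z powi k * laurent_eval p z"
proof -
  have "Poly_Mapping.single k v * p
      = (\<Sum>j\<in>Poly_Mapping.keys p. Poly_Mapping.single (k + j) (v * Poly_Mapping.lookup p j))"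
    by (subst sum_single_lookup[symmetric]) (simp add: sum_distrib_left mult_single)
  then have "laurent_eval (Poly_Mapping.single k v * p) z
      = (\<Sum>j\<in>Poly_Mapping.keys p. v * Poly_Mapping.lookup p j * z powi (k + j))"
    by (simp only: laurent_eval_sum laurent_eval_single)
  then show ?thesis
    using assms by (simp add: laurent_eval_def sum_distrib_left power_int_add mult_ac)
qed

text \<open>Multiplication by a high power of z gives a polynomial with infinitely many
  roots.\<close>

lemma laurent_eq_0:
  assumes "infinite Z" "\<And>z. z \<in> Z \<Longrightarrow> laurent_eval p z = 0"
  shows "p = 0"
proof -
  \<comment> \<open>A crude bound for the absolute value of every exponent, so that z^m clears the
    negative powers.\<close>
  define m where "m = (\<Sum>i\<in>Poly_Mapping.keys p. nat \<bar>i\<bar>)"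
  have m: "- int m \<le> j" if "j \<in> Poly_Mapping.keys p" for j
  proof -
    have "nat \<bar>j\<bar> \<le> m" unfolding m_def using that by (intro member_le_sum) auto
    then show ?thesis by linarith
  qed
  define q where "q = (\<Sum>j\<in>Poly_Mapping.keys p. Polynomial.monom (Poly_Mapping.lookup p j) (nat (j + int m)))"
  have q_eval: "poly q z = z ^ m * laurent_eval p z" if "z \<noteq> 0" for z
  proof -
    have "z ^ nat (j + int m) = z ^ m * z powi j" if "j \<in> Poly_Mapping.keys p" for j
    proof -
      have "z ^ nat (j + int m) = z powi (j + int m)"
        using m[OF that] by (simp add: power_int_def)
      then show ?thesis using \<open>z \<noteq> 0\<close> by (simp add: power_int_add)
    qed
    then show ?thesis
      by (simp add: q_def poly_sum poly_monom laurent_eval_def sum_distrib_left mult_ac)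
  qed
  have "infinite (Z - {0})" using assms(1) by simp
  moreover have "Z - {0} \<subseteq> {z. poly q z = 0}" using assms(2) q_eval by auto
  ultimately have "q = 0" using poly_roots_finite finite_subset by blast
  show "p = 0"
  proof (rule poly_mapping_eqI)
    fix j
    have "Poly_Mapping.lookup p j = 0" if "j \<in> Poly_Mapping.keys p"
    proof -
      have "coeff q (nat (j + int m))
          = (\<Sum>i\<in>Poly_Mapping.keys p. if i = j then Poly_Mapping.lookup p i else 0)"
        unfolding q_def coeff_sum coeff_monom
      proof (intro sum.cong refl)
        fix i assume "i \<in> Poly_Mapping.keys p"
        then have "nat (i + int m) = nat (j + int m) \<longleftrightarrow> i = j"
          using m[of i] m[OF that] by (simp add: eq_nat_nat_iff)
        then show "(if nat (i + int m) = nat (j + int m) then Poly_Mapping.lookup p i else 0)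
            = (if i = j then Poly_Mapping.lookup p i else 0)" by simp
      qed
      then show ?thesis using that \<open>q = 0\<close> by simp
    qed
    then show "Poly_Mapping.lookup p j = Poly_Mapping.lookup 0 j"
      by (auto simp: in_keys_iff)
  qed
qed

text \<open>The argument \<open>(1 - x)/2\<close> of the hypergeometric function, for \<open>x = (z + 1/z)/2\<close>.\<close>

definition jacobi_var :: "complex \<Rightarrow> complex" where
  "jacobi_var z = (2 - z - inverse z) / 4"

text \<open>Since t = 1/2 - z/4 - 1/(4z), the extreme terms of t^n are (-1/4)^n z^n and (-1/4)^n
  z^(-n). Here \<open>n\<close> is only a degree bound, and \<open>coeff p n\<close> may be
  zero.\<close>

lemma laurent_of_poly_jacobi_var:
  assumes "\<And>i. i > n \<Longrightarrow> coeff p i = 0"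
  shows "\<exists>q. (\<forall>z. z \<noteq> 0 \<longrightarrow> laurent_eval q z = poly p (jacobi_var z))
    \<and> (\<forall>j. \<bar>j\<bar> > int n \<longrightarrow> Poly_Mapping.lookup q j = 0)
    \<and> Poly_Mapping.lookup q (int n) = coeff p n * (-1/4) ^ n
    \<and> Poly_Mapping.lookup q (- int n) = coeff p n * (-1/4) ^ n"
  using assms
proof (induction n arbitrary: p)
  case 0
  have "degree p = 0" using 0 by (simp add: degree_le le_antisym flip: le_zero_eq)
  then obtain a where "p = [:a:]" by (rule degree_eq_zeroE)
  then show ?case
    by (intro exI[of _ "Poly_Mapping.single 0 a"]) (auto simp: lookup_single when_def)
next
  case (Suc n)
  obtain a p' where p: "p = pCons a p'" by (rule pCons_cases)
  have "coeff p' i = 0" if "i > n" for i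
    using Suc.prems[of "Suc i"] that by (simp add: p)
  from Suc.IH[OF this] obtain q' where q':
      "\<And>z. z \<noteq> 0 \<Longrightarrow> laurent_eval q' z = poly p' (jacobi_var z)"
      "\<And>j. \<bar>j\<bar> > int n \<Longrightarrow> Poly_Mapping.lookup q' j = 0"
      "Poly_Mapping.lookup q' (int n) = coeff p' n * (-1/4) ^ n"
      "Poly_Mapping.lookup q' (- int n) = coeff p' n * (-1/4) ^ n"
    by blast
  \<comment> \<open>A Horner step: \<open>a + t q'\<close> with t written out in powers of
    z.\<close>
  define q where "q = Poly_Mapping.single 0 a + (Poly_Mapping.single 0 (1/2) * q'
      + (Poly_Mapping.single 1 (-1/4) * q' + Poly_Mapping.single (-1) (-1/4) * q'))"
  have look: "Poly_Mapping.lookup q j = (if j = 0 then a else 0) + Poly_Mapping.lookup q' j / 2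
      - Poly_Mapping.lookup q' (j - 1) / 4 - Poly_Mapping.lookup q' (j + 1) / 4" for j
    unfolding q_def lookup_add lookup_single_times by (simp add: lookup_single when_def)
  have "laurent_eval q z = poly p (jacobi_var z)" if "z \<noteq> 0" for z
  proof -
    have "laurent_eval q z = a + (1/2 - z / 4 - inverse z / 4) * poly p' (jacobi_var z)"
      using that q'(1)[OF that]
      by (simp only: q_def laurent_eval_add laurent_eval_single laurent_eval_single_times[OF that])
         (simp add: power_int_minus algebra_simps)
    also have "1/2 - z / 4 - inverse z / 4 = jacobi_var z"
      by (simp add: jacobi_var_def diff_divide_distrib)
    finally show ?thesis by (simp add: p)
  qed
  moreover have "Poly_Mapping.lookup q j = 0" if "\<bar>j\<bar> > int (Suc n)" for j
  proof -
    have "\<bar>j\<bar> > int n" "\<bar>j - 1\<bar> > int n" "\<bar>j + 1\<bar> > int n" "j \<noteq> 0"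
      using that by auto
    then show ?thesis by (simp add: look q'(2))
  qed
  moreover have "Poly_Mapping.lookup q (int (Suc n)) = coeff p (Suc n) * (-1/4) ^ Suc n"
      "Poly_Mapping.lookup q (- int (Suc n)) = coeff p (Suc n) * (-1/4) ^ Suc n"
    using q'(2)[of "int n + 1"] q'(2)[of "int n + 2"] q'(2)[of "- 1 - int n"] q'(2)[of "- int n - 2"] q'(3,4)
    by (simp_all add: look p algebra_simps)
  ultimately show ?case by blast
qed

section \<open>Leading monomials and decompositions f1(t) + z f2(t)\<close>

lemma monomial_less_nonpos: "monomial_less j (- int N) \<longleftrightarrow> - int N < j \<and> j \<le> int N"
  by (auto simp: monomial_less_def monomial_rank_def)

text \<open>The exponents -N and N + 1 have the consecutive ranks 2N and 2N + 1, so compared with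
  \<open>monomial_less_nonpos\<close> just -N is added.\<close>

lemma monomial_less_pos: "monomial_less j (int N + 1) \<longleftrightarrow> - int N \<le> j \<and> j \<le> int N"
  by (auto simp: monomial_less_def monomial_rank_def)

text \<open>The exponents of f1(t) lie between -N and N, those of z f2(t) between 2 - N and N, so
  z^(-N) gets its coefficient from \<open>f1\<close> alone.\<close>

lemma laurent_with_leading_nonpos:
  assumes f1: "\<And>i. i > N \<Longrightarrow> coeff f1 i = 0" and f2: "\<And>i. i \<ge> N \<Longrightarrow> coeff f2 i = 0"
    and lead: "coeff f1 N * (-1/4) ^ N = 1"
  obtains E where "\<And>z. z \<noteq> 0 \<Longrightarrow> laurent_eval E z = poly f1 (jacobi_var z) + z * poly f2 (jacobi_var z)"
    "Poly_Mapping.keys (E - monomial (- int N)) \<subseteq> {j. monomial_less j (- int N)}"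
proof -
  obtain q1 where q1: "\<And>z. z \<noteq> 0 \<Longrightarrow> laurent_eval q1 z = poly f1 (jacobi_var z)"
      "\<And>j. \<bar>j\<bar> > int N \<Longrightarrow> Poly_Mapping.lookup q1 j = 0" "Poly_Mapping.lookup q1 (- int N) = 1"
    using laurent_of_poly_jacobi_var[of N f1] f1 lead by auto
  \<comment> \<open>The degree bound \<open>N\<close> with vanishing top coefficient, instead of N -
    1, covers N = 0 as well.\<close>
  obtain q2 where q2: "\<And>z. z \<noteq> 0 \<Longrightarrow> laurent_eval q2 z = poly f2 (jacobi_var z)"
      "\<And>j. \<bar>j\<bar> > int N \<Longrightarrow> Poly_Mapping.lookup q2 j = 0"
      "Poly_Mapping.lookup q2 (int N) = 0" "Poly_Mapping.lookup q2 (- int N) = 0"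
    using laurent_of_poly_jacobi_var[of N f2] f2 by auto
  define E where "E = q1 + Poly_Mapping.single 1 1 * q2"
  have q2': "Poly_Mapping.lookup q2 j = 0" if "\<bar>j\<bar> \<ge> int N" for j
    using that q2(2-4) by (cases "j = int N"; cases "j = - int N") auto
  have "monomial_less j (- int N)" if "j \<in> Poly_Mapping.keys (E - monomial (- int N))" for j
  proof (rule ccontr)
    assume *: "\<not> monomial_less j (- int N)"
    then have "\<bar>j - 1\<bar> \<ge> int N" unfolding monomial_less_nonpos by auto
    then have "Poly_Mapping.lookup (E - monomial (- int N)) j = 0"
      using q1(2)[of j] q1(3) q2'[of "j - 1"] *
      by (cases "j = - int N")
         (auto simp: E_def lookup_add lookup_minus lookup_single_times lookup_single when_def monomial_less_nonpos)
    with that show False by (simp add: in_keys_iff)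
  qed
  then show ?thesis
    using that[of E] q1(1) q2(1) by (auto simp: E_def laurent_eval_single_times)
qed

text \<open>Now z f2(t) has exponents between 1 - N and N + 1, so z^(N+1) gets its coefficient from
  \<open>f2\<close> alone.\<close>

lemma laurent_with_leading_pos:
  assumes f1: "\<And>i. i > N \<Longrightarrow> coeff f1 i = 0" and f2: "\<And>i. i > N \<Longrightarrow> coeff f2 i = 0"
    and lead: "coeff f2 N * (-1/4) ^ N = 1"
  obtains E where "\<And>z. z \<noteq> 0 \<Longrightarrow> laurent_eval E z = poly f1 (jacobi_var z) + z * poly f2 (jacobi_var z)"
    "Poly_Mapping.keys (E - monomial (int N + 1)) \<subseteq> {j. monomial_less j (int N + 1)}"
proof -
  obtain q1 where q1: "\<And>z. z \<noteq> 0 \<Longrightarrow> laurent_eval q1 z = poly f1 (jacobi_var z)"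
      "\<And>j. \<bar>j\<bar> > int N \<Longrightarrow> Poly_Mapping.lookup q1 j = 0"
    using laurent_of_poly_jacobi_var[of N f1] f1 by auto
  obtain q2 where q2: "\<And>z. z \<noteq> 0 \<Longrightarrow> laurent_eval q2 z = poly f2 (jacobi_var z)"
      "\<And>j. \<bar>j\<bar> > int N \<Longrightarrow> Poly_Mapping.lookup q2 j = 0" "Poly_Mapping.lookup q2 (int N) = 1"
    using laurent_of_poly_jacobi_var[of N f2] f2 lead by auto
  define E where "E = q1 + Poly_Mapping.single 1 1 * q2"
  have "monomial_less j (int N + 1)" if "j \<in> Poly_Mapping.keys (E - monomial (int N + 1))" for j
  proof (rule ccontr)
    assume *: "\<not> monomial_less j (int N + 1)"
    then have "Poly_Mapping.lookup (E - monomial (int N + 1)) j = 0"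
      using q1(2)[of j] q2(2)[of "j - 1"] q2(3)
      by (cases "j = int N + 1")
         (auto simp: E_def lookup_add lookup_minus lookup_single_times lookup_single when_def monomial_less_pos)
    with that show False by (simp add: in_keys_iff)
  qed
  then show ?thesis
    using that[of E] q1(1) q2(1) by (auto simp: E_def laurent_eval_single_times)
qed

lemma jacobi_var_double: "2 - 4 * jacobi_var z = z + inverse z"
  by (simp add: jacobi_var_def diff_divide_distrib)

text \<open>The recursion comes from 1/z = 2x - z, where 2x = 2 - 4t: dividing f1 + z f2 by z gives
  (2x f1 + f2) - z f1.\<close>

lemma monomial_nonpos_decomp:
  "\<exists>f1 f2. (\<forall>z. z \<noteq> 0 \<longrightarrow> z powi (- int N) = poly f1 (jacobi_var z) + z * poly f2 (jacobi_var z))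
     \<and> (\<forall>i>N. coeff f1 i = 0) \<and> (\<forall>i\<ge>N. coeff f2 i = 0)"
proof (induction N)
  case 0
  show ?case by (intro exI[of _ 1] exI[of _ 0]) auto
next
  case (Suc N)
  then obtain f1 f2 where f: "\<And>z. z \<noteq> 0 \<Longrightarrow> z powi (- int N) = poly f1 (jacobi_var z) + z * poly f2 (jacobi_var z)"
      "\<And>i. i > N \<Longrightarrow> coeff f1 i = 0" "\<And>i. i \<ge> N \<Longrightarrow> coeff f2 i = 0" by blast
  have "z powi (- int (Suc N)) = poly ([:2, -4:] * f1 + f2) (jacobi_var z) + z * poly (- f1) (jacobi_var z)"
    if "z \<noteq> 0" for z
  proof -
    have "z powi (- int (Suc N)) = inverse z * z powi (- int N)"
      by (simp only: power_int_minus power_int_of_nat) simp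
    also have "\<dots> = inverse z * poly f1 (jacobi_var z) + poly f2 (jacobi_var z)"
      using that f(1) by (simp add: distrib_left)
    also have "inverse z = (2 - 4 * jacobi_var z) - z" by (simp add: jacobi_var_double)
    finally show ?thesis by (simp add: algebra_simps)
  qed
  moreover have "\<forall>i>Suc N. coeff ([:2, -4:] * f1 + f2) i = 0"
    using f(2,3) by (auto simp: coeff_pCons split: nat.split)
  moreover have "\<forall>i\<ge>Suc N. coeff (- f1) i = 0" using f(2) by auto
  ultimately show ?case by blast
qed

text \<open>The recursion comes from z^2 = 2x z - 1: multiplying f1 + z f2 by z gives - f2 + z (f1 +
  2x f2).\<close>

lemma monomial_pos_decomp:
  "\<exists>f1 f2. (\<forall>z. z \<noteq> 0 \<longrightarrow> z powi (int N + 1) = poly f1 (jacobi_var z) + z * poly f2 (jacobi_var z))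
     \<and> (\<forall>i>N. coeff f1 i = 0) \<and> (\<forall>i>N. coeff f2 i = 0)"
proof (induction N)
  case 0
  show ?case by (intro exI[of _ 0] exI[of _ "[:1:]"]) (auto simp: coeff_pCons split: nat.split)
next
  case (Suc N)
  then obtain f1 f2 where f: "\<And>z. z \<noteq> 0 \<Longrightarrow> z powi (int N + 1) = poly f1 (jacobi_var z) + z * poly f2 (jacobi_var z)"
      "\<And>i. i > N \<Longrightarrow> coeff f1 i = 0" "\<And>i. i > N \<Longrightarrow> coeff f2 i = 0" by blast
  have "z powi (int (Suc N) + 1) = poly (- f2) (jacobi_var z) + z * poly (f1 + [:2, -4:] * f2) (jacobi_var z)"
    if "z \<noteq> 0" for z
  proof -
    have "z powi (int (Suc N) + 1) = z * z powi (int N + 1)"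
      using that by (simp add: power_int_add power2_eq_square)
    also have "\<dots> = z * poly f1 (jacobi_var z) + z * z * poly f2 (jacobi_var z)"
      using that f(1) by (simp add: distrib_left)
    also have "z * z = z * (2 - 4 * jacobi_var z) - 1" using that unfolding jacobi_var_double by (simp add: distrib_left power2_eq_square)
    finally show ?thesis by (simp add: algebra_simps)
  qed
  moreover have "\<forall>i>Suc N. coeff (f1 + [:2, -4:] * f2) i = 0"
    using f(2,3) by (auto simp: coeff_pCons split: nat.split)
  moreover have "\<forall>i>Suc N. coeff (- f2) i = 0" using f(3) by auto
  ultimately show ?case by blast
qed

section \<open>The inner product on the circle\<close>

text \<open>With \<open>0\<close> to the power \<open>0\<close> equal to \<open>1\<close>, the weight becomes continuous on the whole circle.\<close>

definition power_or_one :: "real \<Rightarrow> real \<Rightarrow> real" where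
  "power_or_one a y = (if a = 0 then 1 else y powr a)"

definition circle_weight :: "real \<times> real \<Rightarrow> real \<Rightarrow> real" where
  "circle_weight k \<theta> = power_or_one (fst k) (1 - cos \<theta>) * power_or_one (snd k) (1 - cos (2 * \<theta>))"

lemma continuous_power_or_one:
  assumes "a \<ge> 0" "continuous_on S f" "\<And>x. x \<in> S \<Longrightarrow> f x \<ge> 0"
  shows "continuous_on S (\<lambda>x. power_or_one a (f x))"
  unfolding power_or_one_def using assms
  by (cases "a = 0") (auto intro!: continuous_on_powr' continuous_on_const simp: less_le)

lemma continuous_circle_weight:
  assumes "k1 \<ge> 0" "k2 \<ge> 0"
  shows "continuous_on S (circle_weight (k1, k2))"
  unfolding circle_weight_def using assms
  by (auto intro!: continuous_intros continuous_power_or_one)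

lemma circle_weight_nonneg: "circle_weight k \<theta> \<ge> 0"
  by (simp add: circle_weight_def power_or_one_def)

lemma circle_weight_pos:
  assumes "0 < \<theta>" "\<theta> < pi"
  shows "circle_weight k \<theta> > 0"
proof -
  have "sin \<theta> > 0" using assms by (rule sin_gt_zero)
  moreover have "cos \<theta> \<noteq> 1"
    using \<open>sin \<theta> > 0\<close> cos_one_sin_zero[of \<theta>] by auto
  then have "1 - cos \<theta> \<noteq> 0" by simp
  ultimately show ?thesis
    by (simp add: circle_weight_def power_or_one_def cos_double_sin)
qed

lemma weight_cis:
  assumes "\<theta> \<in> {0..2*pi} - {0, pi, 2*pi}"
  shows "weight k (cis \<theta>) = of_real (circle_weight k \<theta>)"
proof -
  have "sin \<theta> \<noteq> 0"
  proof (cases "\<theta> < pi")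
    case True
    then show ?thesis using assms sin_gt_zero[of \<theta>] by auto
  next
    case False
    then show ?thesis using assms sin_gt_zero[of "\<theta> - pi"] by auto
  qed
  then have ne: "1 - cos \<theta> \<noteq> 0" "1 - cos (2 * \<theta>) \<noteq> 0"
    using cos_one_sin_zero[of \<theta>] by (auto simp: cos_double_sin)
  have "1 - (cis \<theta> + inverse (cis \<theta>)) / 2 = of_real (1 - cos \<theta>)"
    "1 - ((cis \<theta>)\<^sup>2 + inverse ((cis \<theta>)\<^sup>2)) / 2 = of_real (1 - cos (2 * \<theta>))"
    by (simp_all add: complex_eq_iff Complex.DeMoivre)
  moreover have "of_real y powr of_real a = complex_of_real (power_or_one a y)" if "y \<ge> 0" "y \<noteq> 0" for a y
    using that by (simp add: power_or_one_def powr_of_real)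
  ultimately show ?thesis
    using ne by (simp add: weight_def circle_weight_def del: of_real_diff)
qed

lemma laurent_inner_circle:
  "laurent_inner k p q = integral {0..2*pi} (\<lambda>\<theta>. of_real (circle_weight k \<theta>)
      * (cnj (laurent_eval p (cis \<theta>)) * laurent_eval q (cis \<theta>)))"
proof -
  have "laurent_inner k p q = integral {0..2*pi}
      (\<lambda>\<theta>. cnj (laurent_eval p (cis \<theta>)) * laurent_eval q (cis \<theta>) * weight k (cis \<theta>) / (\<i> * cis \<theta>) * \<i> * cis \<theta>)"
    unfolding laurent_inner_def circlepath_def
    by (subst contour_integral_part_circlepath_eq) auto
  \<comment> \<open>The two weights can differ only at z = 1 and z = -1, that is, at three
    angles.\<close>
  also have "\<dots> = integral {0..2*pi} (\<lambda>\<theta>. of_real (circle_weight k \<theta>)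
      * (cnj (laurent_eval p (cis \<theta>)) * laurent_eval q (cis \<theta>)))"
    by (rule integral_spike[of "{0, pi, 2*pi}"]) (auto simp: weight_cis)
  finally show ?thesis .
qed

text \<open>For \<open>k = (k1, k2)\<close> and t = (1 - cos \<theta>)/2 the weight is a constant
  times t^(k1+k2) (1-t)^k2, and dt = sqrt(t (1-t)) d\<theta> up to sign. So this is a multiple of
  the integral of p t^\<alpha> (1-t)^\<beta> over [0, 1], kept on the circle to avoid the
  substitution.\<close>

definition jacobi_integral :: "real \<times> real \<Rightarrow> complex poly \<Rightarrow> complex" where
  "jacobi_integral k p = integral {0..2*pi}
     (\<lambda>\<theta>. of_real (circle_weight k \<theta>) * poly p (of_real ((1 - cos \<theta>) / 2)))"

text \<open>The reflection, which is complex conjugation on the circle, preserves the integral. This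
  removes the cross terms in \<open>laurent_inner_split\<close>.\<close>

lemma integral_odd_on_circle:
  fixes f :: "real \<Rightarrow> complex"
  assumes "\<And>\<theta>. f (2 * pi - \<theta>) = - f \<theta>"
  shows "integral {0..2*pi} f = 0"
proof -
  have "integral {0..2*pi} (\<lambda>\<theta>. f (2 * pi - \<theta>)) = integral {0 - 2*pi..2*pi - 2*pi} (\<lambda>\<theta>. f (- \<theta>))"
    by (subst integral_shift_real_ivl[symmetric, where c = "2*pi"]) simp
  also have "\<dots> = integral {0..2*pi} f"
    using Henstock_Kurzweil_Integration.integral_reflect_real[of "2*pi" 0 f] by simp
  finally show ?thesis by (simp add: assms)
qed

lemma jacobi_var_cis: "jacobi_var (cis \<theta>) = of_real ((1 - cos \<theta>) / 2)"
  by (simp add: jacobi_var_def complex_eq_iff)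

lemma continuous_circle_poly:
  assumes "k1 \<ge> 0" "k2 \<ge> 0"
  shows "continuous_on S (\<lambda>\<theta>. of_real (circle_weight (k1, k2) \<theta>) * poly p (complex_of_real ((1 - cos \<theta>) / 2)))"
  using continuous_circle_weight[OF assms] by (auto intro!: continuous_intros)

text \<open>By logarithmic differentiation; the factor sin \<theta> clears the denominators 1 - cos
  \<theta> and 1 - cos (2 \<theta>).\<close>

lemma circle_weight_derivative:
  assumes "sin \<theta> \<noteq> 0"
  shows "((\<lambda>\<theta>. sin \<theta> * circle_weight (k1, k2) \<theta>) has_real_derivative
     ((k1 + 2 * k2 + 1) * cos \<theta> + k1) * circle_weight (k1, k2) \<theta>) (at \<theta>)"
proof -
  have ne: "1 - cos \<theta> \<noteq> 0" "1 - cos (2 * \<theta>) \<noteq> 0"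
    using assms cos_one_sin_zero[of \<theta>] by (auto simp: cos_double_sin)
  then have pos: "1 - cos \<theta> > 0" "1 - cos (2 * \<theta>) > 0"
    by (simp_all add: less_le)
  have d: "((\<lambda>\<theta>. power_or_one a (f \<theta>)) has_real_derivative a * f' / f \<theta> * power_or_one a (f \<theta>)) (at \<theta>)"
    if "(f has_real_derivative f') (at \<theta>)" "f \<theta> > 0" for a f f'
  proof (cases "a = 0")
    case False
    have "((\<lambda>\<theta>. f \<theta> powr a) has_real_derivative a * f' / f \<theta> * f \<theta> powr a) (at \<theta>)"
      by (rule derivative_eq_intros that refl)+ 
         (use that powr_mult_base[of "f \<theta>" "a - 1"] in \<open>auto simp: field_simps\<close>)
    then show ?thesis using False by (simp add: power_or_one_def)
  qed (simp add: power_or_one_def)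
  have "((\<lambda>\<theta>. 1 - cos \<theta>) has_real_derivative sin \<theta>) (at \<theta>)"
    by (auto intro!: derivative_eq_intros)
  note d1 = d[OF this pos(1), of k1]
  have "((\<lambda>\<theta>. 1 - cos (2 * \<theta>)) has_real_derivative 2 * sin (2 * \<theta>)) (at \<theta>)"
    by (auto intro!: derivative_eq_intros)
  note d2 = d[OF this pos(2), of k2]
  have "((\<lambda>\<theta>. sin \<theta> * circle_weight (k1, k2) \<theta>) has_real_derivative
     (cos \<theta> + k1 * (sin \<theta> * sin \<theta> / (1 - cos \<theta>))
        + k2 * (2 * sin \<theta> * sin (2 * \<theta>) / (1 - cos (2 * \<theta>)))) * circle_weight (k1, k2) \<theta>) (at \<theta>)"
    unfolding circle_weight_def fst_conv snd_conv
    by (rule derivative_eq_intros d1 d2 refl)+ (simp add: algebra_simps)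
  note D = this
  have e1: "sin \<theta> * sin \<theta> / (1 - cos \<theta>) = 1 + cos \<theta>"
    using ne sin_squared_eq[of \<theta>] by (simp add: field_simps power2_eq_square)
  have e2: "2 * sin \<theta> * sin (2 * \<theta>) / (1 - cos (2 * \<theta>)) = 2 * cos \<theta>"
    using assms by (simp only: sin_double cos_double_sin) (simp add: field_simps power2_eq_square)
  from D[unfolded e1 e2] show ?thesis by (simp add: algebra_simps)
qed

lemma poly_half_cos_derivative:
  "((\<lambda>\<theta>. poly p (complex_of_real ((1 - cos \<theta>) / 2))) has_vector_derivative
     of_real (sin \<theta> / 2) * poly (pderiv p) (of_real ((1 - cos \<theta>) / 2))) (at \<theta>)"
proof -
  have "((\<lambda>y. poly p (complex_of_real y)) has_vector_derivative poly (pderiv p) (of_real y)) (at y)" for y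
    by (rule has_vector_derivative_real_field) (rule poly_DERIV)
  note p = this
  have "((\<lambda>\<theta>. (1 - cos \<theta>) / 2) has_vector_derivative sin \<theta> / 2) (at \<theta>)"
    by (auto intro!: derivative_eq_intros simp flip: has_real_derivative_iff_has_vector_derivative)
  from vector_diff_chain_at[OF this p] show ?thesis
    by (simp add: o_def scaleR_conv_of_real)
qed

lemma jacobi_functional_integral:
  assumes k: "k1 \<ge> 0" "k2 \<ge> 0"
  shows "jacobi_functional (jacobi_integral (k1, k2)) (of_real (k1 + k2 + 1 / 2)) (of_real (k1 + 2 * k2 + 1))"
proof
  fix p q :: "complex poly" and a
  note int = integrable_continuous_interval[OF continuous_circle_poly[OF k]]
  show "jacobi_integral (k1, k2) (p + q) = jacobi_integral (k1, k2) p + jacobi_integral (k1, k2) q"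
    unfolding jacobi_integral_def by (subst integral_add[symmetric, OF int int]) (simp add: algebra_simps)
  show "jacobi_integral (k1, k2) (Polynomial.smult a p) = a * jacobi_integral (k1, k2) p"
    unfolding jacobi_integral_def by (subst integral_mult_right[symmetric]) (simp add: algebra_simps)
  let ?w = "circle_weight (k1, k2)"
  let ?r = "[:0, 1, -1:] * pderiv p + [:of_real (k1 + k2 + 1 / 2), - of_real (k1 + 2 * k2 + 1):] * p"
  \<comment> \<open>\<open>G\<close> vanishes at 0 and 2 pi because of the sine. As sin^2 \<theta> =
    4 t (1 - t) and cos \<theta> = 1 - 2 t, its derivative is twice the integrand \<open>g\<close>
    of the identity to be shown.\<close>
  define G where "G = (\<lambda>\<theta>. of_real (sin \<theta> * ?w \<theta>) * poly p (of_real ((1 - cos \<theta>) / 2)))"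
  define g where "g = (\<lambda>\<theta>. of_real (?w \<theta>) * poly ?r (of_real ((1 - cos \<theta>) / 2)))"
  \<comment> \<open>The weight need not be differentiable at \<open>pi\<close> or at the end points;
    continuity of \<open>G\<close> suffices there.\<close>
  have "((\<lambda>\<theta>. 2 * g \<theta>) has_integral (G (2 * pi) - G 0)) {0..2*pi}"
  proof (rule fundamental_theorem_of_calculus_interior_strong[where S = "{pi}"])
    show "continuous_on {0..2*pi} G"
      unfolding G_def using continuous_circle_weight[OF k] by (auto intro!: continuous_intros)
    fix \<theta> assume \<theta>: "\<theta> \<in> {0<..<2*pi} - {pi}"
    then have "sin \<theta> \<noteq> 0"
      using sin_gt_zero[of \<theta>] sin_gt_zero[of "\<theta> - pi"] by (cases "\<theta> < pi") auto
    from has_vector_derivative_mult[OF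
        has_vector_derivative_of_real[OF circle_weight_derivative[OF this, of k1 k2]] poly_half_cos_derivative[of p \<theta>]]
    have "(G has_vector_derivative
       (of_real (sin \<theta> * ?w \<theta>) * (of_real (sin \<theta> / 2) * poly (pderiv p) (of_real ((1 - cos \<theta>) / 2))) +
        of_real (((k1 + 2 * k2 + 1) * cos \<theta> + k1) * ?w \<theta>) * poly p (of_real ((1 - cos \<theta>) / 2)))) (at \<theta>)"
      unfolding G_def .
    also have "of_real (sin \<theta> * ?w \<theta>) * (of_real (sin \<theta> / 2) * poly (pderiv p) (of_real ((1 - cos \<theta>) / 2))) +
        of_real (((k1 + 2 * k2 + 1) * cos \<theta> + k1) * ?w \<theta>) * poly p (of_real ((1 - cos \<theta>) / 2)) = 2 * g \<theta>"
    proof -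
      have "complex_of_real (sin \<theta>) * of_real (sin \<theta>) = 1 - of_real (cos \<theta>) * of_real (cos \<theta>)"
        using arg_cong[OF sin_squared_eq[of \<theta>], of complex_of_real] by (simp add: power2_eq_square)
      then have "of_real (sin \<theta> * ?w \<theta>) * (of_real (sin \<theta> / 2) * y)
          = (1 - of_real (cos \<theta>) * of_real (cos \<theta>)) * (of_real (?w \<theta>) * y / 2)" for y :: complex
        by (metis (no_types, opaque_lifting) mult.assoc mult.commute of_real_divide of_real_mult
            of_real_numeral times_divide_eq_right)
      then show ?thesis
        by (simp only: g_def) (simp add: field_simps)
    qed
    finally show "(G has_vector_derivative 2 * g \<theta>) (at \<theta>)" .
  qed auto
  moreover have "G (2 * pi) = 0" "G 0 = 0" by (simp_all add: G_def)
  ultimately have "((\<lambda>\<theta>. g \<theta>) has_integral 0) {0..2*pi}"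
    using has_integral_mult_right[of "\<lambda>\<theta>. 2 * g \<theta>" 0 "{0..2*pi}" "1/2"] by simp
  then show "jacobi_integral (k1, k2) ?r = 0"
    unfolding jacobi_integral_def g_def by (rule integral_unique)
qed

section \<open>Orthogonal splitting along 1 - z and 1 + z\<close>

definition has_split :: "laurent_poly \<Rightarrow> complex poly \<Rightarrow> complex poly \<Rightarrow> bool" where
  "has_split E u v \<longleftrightarrow>
     (\<forall>z. z \<noteq> 0 \<longrightarrow> laurent_eval E z = (1 - z) * poly u (jacobi_var z) + (1 + z) * poly v (jacobi_var z))"

text \<open>On the circle |1 - z|^2 = 4 t and |1 + z|^2 = 4 (1 - t), which gives the two weights and
  the factor 4. The cross terms are odd, and reality of \<open>u\<close> and \<open>v\<close>
  removes the conjugation.\<close>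

lemma laurent_inner_split:
  assumes k: "k1 \<ge> 0" "k2 \<ge> 0"
    and E: "has_split E u v"
    and F: "has_split F u' v'"
    and u: "\<And>y::real. poly u (of_real y) \<in> \<real>" and v: "\<And>y::real. poly v (of_real y) \<in> \<real>"
  shows "laurent_inner (k1, k2) E F
    = 4 * (jacobi_integral (k1, k2) ([:0, 1:] * (u * u')) + jacobi_integral (k1, k2) ([:1, -1:] * (v * v')))"
proof -
  interpret jacobi_functional "jacobi_integral (k1, k2)" "of_real (k1 + k2 + 1 / 2)" "of_real (k1 + 2 * k2 + 1)"
    using k by (rule jacobi_functional_integral)
  let ?w = "circle_weight (k1, k2)"
  let ?t = "\<lambda>\<theta>. complex_of_real ((1 - cos \<theta>) / 2)"
  \<comment> \<open>\<open>p\<close> is the even part of the integrand, and \<open>r\<close> the odd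
    part after a factor sin \<theta> is taken out.\<close>
  define p where "p = [:0, 4:] * (u * u') + [:4, -4:] * (v * v')"
  define r where "r = Polynomial.smult (2 * \<i>) (u * v' - v * u')"
  have "of_real (?w \<theta>) * (cnj (laurent_eval E (cis \<theta>)) * laurent_eval F (cis \<theta>))
      = of_real (?w \<theta>) * poly p (?t \<theta>) + of_real (sin \<theta>) * (of_real (?w \<theta>) * poly r (?t \<theta>))" for \<theta>
  proof -
    have cnj: "cnj (poly u (?t \<theta>)) = poly u (?t \<theta>)" "cnj (poly v (?t \<theta>)) = poly v (?t \<theta>)"
      using u v by (simp_all only: Reals_cnj_iff)
    have 1: "(1 - cnj (cis \<theta>)) * (1 - cis \<theta>) = 4 * ?t \<theta>"
      "(1 + cnj (cis \<theta>)) * (1 + cis \<theta>) = 4 - 4 * ?t \<theta>"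
      "(1 - cnj (cis \<theta>)) * (1 + cis \<theta>) = 2 * \<i> * of_real (sin \<theta>)"
      "(1 + cnj (cis \<theta>)) * (1 - cis \<theta>) = - (2 * \<i> * of_real (sin \<theta>))"
      using sin_squared_eq[of \<theta>]
      by (auto simp: complex_eq_iff algebra_simps power2_eq_square diff_divide_distrib)
    have "cnj (laurent_eval E (cis \<theta>)) * laurent_eval F (cis \<theta>)
      = ((1 - cnj (cis \<theta>)) * (1 - cis \<theta>)) * (poly u (?t \<theta>) * poly u' (?t \<theta>))
      + ((1 + cnj (cis \<theta>)) * (1 + cis \<theta>)) * (poly v (?t \<theta>) * poly v' (?t \<theta>))
      + ((1 - cnj (cis \<theta>)) * (1 + cis \<theta>)) * (poly u (?t \<theta>) * poly v' (?t \<theta>))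
      + ((1 + cnj (cis \<theta>)) * (1 - cis \<theta>)) * (poly v (?t \<theta>) * poly u' (?t \<theta>))"
      using E[unfolded has_split_def, rule_format, of "cis \<theta>"] F[unfolded has_split_def, rule_format, of "cis \<theta>"]
      unfolding jacobi_var_cis by (simp add: cnj del: of_real_divide of_real_diff) (simp only: algebra_simps)
    also have "\<dots> = poly p (?t \<theta>) + of_real (sin \<theta>) * poly r (?t \<theta>)"
      unfolding 1 by (simp add: p_def r_def algebra_simps del: of_real_divide of_real_diff)
    finally show ?thesis by (simp only: algebra_simps)
  qed
  then have "laurent_inner (k1, k2) E F = integral {0..2*pi}
      (\<lambda>\<theta>. of_real (?w \<theta>) * poly p (?t \<theta>) + of_real (sin \<theta>) * (of_real (?w \<theta>) * poly r (?t \<theta>)))"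
    unfolding laurent_inner_circle by simp
  also have "\<dots> = integral {0..2*pi} (\<lambda>\<theta>. of_real (?w \<theta>) * poly p (?t \<theta>))
      + integral {0..2*pi} (\<lambda>\<theta>. of_real (sin \<theta>) * (of_real (?w \<theta>) * poly r (?t \<theta>)))"
    by (intro integral_add integrable_continuous_interval continuous_intros continuous_circle_poly[OF k])
  also have "integral {0..2*pi} (\<lambda>\<theta>. of_real (sin \<theta>) * (of_real (?w \<theta>) * poly r (?t \<theta>))) = 0"
    by (rule integral_odd_on_circle)
       (simp add: circle_weight_def sin_diff cos_diff right_diff_distrib mult.assoc[symmetric] sin_double cos_double)
  also have "integral {0..2*pi} (\<lambda>\<theta>. of_real (?w \<theta>) * poly p (?t \<theta>)) = jacobi_integral (k1, k2) p"
    by (simp add: jacobi_integral_def)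
  also have "p = Polynomial.smult 4 ([:0, 1:] * (u * u') + [:1, -1:] * (v * v'))"
    by (simp add: p_def smult_add_right smult_diff_right algebra_simps)
  finally show ?thesis by (simp only: smult add) simp
qed

lemma laurent_eval_cis_continuous: "continuous_on S (\<lambda>\<theta>. laurent_eval p (cis \<theta>))"
  unfolding laurent_eval_def by (intro continuous_intros continuous_on_sum continuous_on_power_int) auto

lemma laurent_inner_diff_left:
  assumes k: "k1 \<ge> 0" "k2 \<ge> 0"
  shows "laurent_inner (k1, k2) (p - q) r = laurent_inner (k1, k2) p r - laurent_inner (k1, k2) q r"
proof -
  have "(\<lambda>\<theta>. of_real (circle_weight (k1, k2) \<theta>) * (cnj (laurent_eval p (cis \<theta>)) * laurent_eval r (cis \<theta>)))
      integrable_on {0..2*pi}" for p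
    by (intro integrable_continuous_interval continuous_intros continuous_circle_weight[OF k]
        laurent_eval_cis_continuous)
  then show ?thesis
    unfolding laurent_inner_circle by (subst integral_diff[symmetric]) (auto simp: algebra_simps)
qed

text \<open>\<open>D\<close> is a combination of its own monomials, so its norm is zero. The weight
  is continuous, and positive on the open upper half circle, so \<open>D\<close> vanishes on an
  arc.\<close>

lemma laurent_inner_orthogonal_unique:
  assumes k: "k1 \<ge> 0" "k2 \<ge> 0"
    and orth: "\<And>j. j \<in> Poly_Mapping.keys D \<Longrightarrow> laurent_inner (k1, k2) D (monomial j) = 0"
  shows "D = 0"
proof -
  let ?w = "circle_weight (k1, k2)"
  let ?e = "\<lambda>\<theta>. laurent_eval D (cis \<theta>)"
  define h where "h = (\<lambda>\<theta>. ?w \<theta> * (cmod (?e \<theta>))\<^sup>2)"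
  have cont: "continuous_on S h" for S
    unfolding h_def
    by (intro continuous_intros continuous_circle_weight[OF k] laurent_eval_cis_continuous)
  have "((\<lambda>\<theta>. complex_of_real (h \<theta>)) has_integral of_real (integral {0..2*pi} h)) {0..2*pi}"
    using has_integral_linear[OF integrable_integral[OF integrable_continuous_interval[OF cont]]
        bounded_linear_of_real, of 0 "2*pi"]
    by (simp add: o_def)
  from integral_unique[OF this, symmetric]
  have "of_real (integral {0..2*pi} h) = integral {0..2*pi} (\<lambda>\<theta>. complex_of_real (h \<theta>))" .
  also have "\<dots> = integral {0..2*pi} (\<lambda>\<theta>. \<Sum>j\<in>Poly_Mapping.keys D. Poly_Mapping.lookup D j *
      (of_real (?w \<theta>) * (cnj (?e \<theta>) * laurent_eval (monomial j) (cis \<theta>))))"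
  proof (rule integral_cong)
    fix \<theta>
    have e: "?e \<theta> = (\<Sum>j\<in>Poly_Mapping.keys D. Poly_Mapping.lookup D j * laurent_eval (monomial j) (cis \<theta>))"
      by (simp add: laurent_eval_def)
    have "complex_of_real (h \<theta>) = of_real (?w \<theta>) * cnj (?e \<theta>) * ?e \<theta>"
      by (simp only: h_def of_real_mult complex_norm_square mult_ac)
    also have "\<dots> = of_real (?w \<theta>) * cnj (?e \<theta>)
        * (\<Sum>j\<in>Poly_Mapping.keys D. Poly_Mapping.lookup D j * laurent_eval (monomial j) (cis \<theta>))"
      by (simp only: e[symmetric])
    finally show "complex_of_real (h \<theta>) = (\<Sum>j\<in>Poly_Mapping.keys D. Poly_Mapping.lookup D j *
      (of_real (?w \<theta>) * (cnj (?e \<theta>) * laurent_eval (monomial j) (cis \<theta>))))"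
      by (simp only: sum_distrib_left mult_ac)
  qed
  also have "\<dots> = (\<Sum>j\<in>Poly_Mapping.keys D. integral {0..2*pi} (\<lambda>\<theta>. Poly_Mapping.lookup D j *
      (of_real (?w \<theta>) * (cnj (?e \<theta>) * laurent_eval (monomial j) (cis \<theta>)))))"
    by (intro integral_sum integrable_continuous_interval continuous_intros
        continuous_circle_weight[OF k] laurent_eval_cis_continuous) auto
  also have "\<dots> = (\<Sum>j\<in>Poly_Mapping.keys D. Poly_Mapping.lookup D j * laurent_inner (k1, k2) D (monomial j))"
    by (simp only: laurent_inner_circle integral_mult_right)
  also have "\<dots> = 0" using orth by simp
  finally have "integral {0..2*pi} h = 0" by simp
  then have "h \<theta> = 0" if "\<theta> \<in> {0..2*pi}" for \<theta>
    using integral_eq_0_iff[OF cont, of 0 "2*pi"] that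
    by (simp add: h_def circle_weight_nonneg)
  then have zero: "laurent_eval D z = 0" if z: "z \<in> cis ` {0<..<pi}" for z
  proof -
    obtain \<theta> where \<theta>: "z = cis \<theta>" "0 < \<theta>" "\<theta> < pi" using z by auto
    then have "h \<theta> = 0" using \<open>\<And>\<theta>. \<theta> \<in> {0..2*pi} \<Longrightarrow> h \<theta> = 0\<close>[of \<theta>] by simp
    then show ?thesis using circle_weight_pos[OF \<theta>(2,3), of "(k1, k2)"] \<theta>(1) by (simp add: h_def)
  qed
  have "inj_on cis {0<..<pi}"
    by (rule inj_onI) (auto intro: cos_inj_pi simp: complex_eq_iff)
  then have "infinite (cis ` {0<..<pi})"
    using infinite_Ioo[OF pi_gt_zero] by (simp add: finite_image_iff)
  then show ?thesis using zero by (rule laurent_eq_0)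
qed

section \<open>Non-symmetric Jacobi polynomials\<close>

text \<open>Two candidates differ by a combination of monomials below z^n, and the difference is
  orthogonal to each of these.\<close>

lemma nonsym_jacobi_eqI:
  assumes k: "k1 \<ge> 0" "k2 \<ge> 0"
    and keys: "Poly_Mapping.keys (E - monomial n) \<subseteq> {j. monomial_less j n}"
    and orth: "\<forall>j. monomial_less j n \<longrightarrow> laurent_inner (k1, k2) E (monomial j) = 0"
  shows "nonsym_jacobi n (k1, k2) = E"
  unfolding nonsym_jacobi_def
proof (rule the_equality)
  fix E'
  assume E': "Poly_Mapping.keys (E' - monomial n) \<subseteq> {j. monomial_less j n}
    \<and> (\<forall>j. monomial_less j n \<longrightarrow> laurent_inner (k1, k2) E' (monomial j) = 0)"
  have "Poly_Mapping.keys (E' - E) \<subseteq> {j. monomial_less j n}"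
    using keys_diff[of "E' - monomial n" "E - monomial n"] keys E' by auto
  then have "E' - E = 0"
    using orth E' by (intro laurent_inner_orthogonal_unique[OF k]) (auto simp: laurent_inner_diff_left[OF k])
  then show "E' = E" by simp
qed (use keys orth in auto)

section \<open>Jacobi polynomials in the variable t = (1 - x)/2\<close>

definition jacobi_poly :: "nat \<Rightarrow> real \<Rightarrow> real \<Rightarrow> complex poly" where
  "jacobi_poly n a b = Polynomial.smult (of_real (pochhammer (a + 1) n / fact n))
     (hypergeo_poly n (of_real (real n + a + b + 1)) (of_real (a + 1)))"

lemma jacobi_P_eq_poly: "jacobi_P n a b x = poly (jacobi_poly n a b) ((1 - x) / 2)"
  by (simp add: jacobi_P_def jacobi_poly_def hypergeo_2F1_eq_poly)

lemma coeff_jacobi_poly_gt: "i > n \<Longrightarrow> coeff (jacobi_poly n a b) i = 0"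
  by (simp add: jacobi_poly_def coeff_hypergeo_poly pochhammer_of_nat_eq_0_iff)

text \<open>The normalising factor cancels the denominator \<open>pochhammer (a + 1) n\<close>,
  nonzero as a > -1. Only a + b remains, so the parameters (\<alpha> + 1, \<beta>) and (\<alpha>,
  \<beta> + 1) share their leading coefficient.\<close>

lemma coeff_jacobi_poly_lead:
  assumes "a > -1"
  shows "coeff (jacobi_poly n a b) n = of_real ((-1) ^ n * pochhammer (real n + a + b + 1) n / fact n)"
proof -
  have "pochhammer (a + 1) n > 0" using assms by (intro pochhammer_pos) simp
  then show ?thesis
    unfolding jacobi_poly_def coeff_smult coeff_hypergeo_poly pochhammer_same pochhammer_of_real
    by simp
qed

lemma poly_jacobi_poly_real: "poly (jacobi_poly n a b) (of_real y) \<in> \<real>"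
proof -
  have "coeff (jacobi_poly n a b) i \<in> \<real>" for i
  proof -
    have "(- of_nat n :: complex) = of_real (- real n)" "(fact i :: complex) = of_real (fact i)"
      by simp_all
    then show ?thesis
      unfolding jacobi_poly_def coeff_smult coeff_hypergeo_poly
      by (simp only: pochhammer_of_real) (intro Reals_mult Reals_divide Reals_of_real)
  qed
  then show ?thesis unfolding poly_altdef by (intro sum_in_Reals Reals_mult Reals_power) auto
qed

lemma jacobi_poly_ode:
  assumes "a > -1"
  shows "hypergeo_op (of_real (a + 1)) (of_real (a + b + 2)) (jacobi_poly n a b)
    = Polynomial.smult (- (of_nat n * (of_nat n + of_real (a + b + 2) - 1))) (jacobi_poly n a b)"
proof -
  have c: "of_real (a + 1) + of_nat j \<noteq> (0 :: complex)" for j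
  proof -
    have "a + 1 + real j > 0" using assms by simp
    then show ?thesis by (metis less_irrefl of_real_add of_real_eq_0_iff of_real_of_nat_eq)
  qed
  have "(of_real (real n + a + b + 1) :: complex) = of_nat n + of_real (a + b + 2) - 1"
    by simp
  moreover have "hypergeo_op c s (Polynomial.smult r p) = Polynomial.smult r (hypergeo_op c s p)"
    for c s r :: complex and p
    by (rule poly_eqI) (simp add: coeff_hypergeo_op algebra_simps)
  ultimately show ?thesis
    by (simp only: jacobi_poly_def hypergeo_poly_ode[OF c] smult_smult mult.commute)
qed

text \<open>Write f1 + z f2 = (1 - z)(f1 - f2)/2 + (1 + z)(f1 + f2)/2. As \<open>f2\<close> has
  degree below \<open>N\<close>, both coefficients at \<open>N\<close> are half that of
  \<open>f1\<close>.\<close>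

lemma monomial_split_le:
  "\<exists>u v. has_split (monomial (- int N)) u v \<and> (\<forall>i>N. coeff u i = 0) \<and> (\<forall>i>N. coeff v i = 0) \<and> coeff u N = coeff v N"
proof -
  obtain f1 f2 where f: "\<And>z. z \<noteq> 0 \<Longrightarrow> z powi (- int N) = poly f1 (jacobi_var z) + z * poly f2 (jacobi_var z)"
      "\<And>i. i > N \<Longrightarrow> coeff f1 i = 0" "\<And>i. i \<ge> N \<Longrightarrow> coeff f2 i = 0"
    using monomial_nonpos_decomp[of N] by blast
  show ?thesis
    by (rule exI[of _ "Polynomial.smult (1/2) (f1 - f2)"], rule exI[of _ "Polynomial.smult (1/2) (f1 + f2)"])
       (use f in \<open>auto simp: has_split_def field_simps\<close>)
qed

lemma monomial_split_less:
  assumes "monomial_less j (- int N)"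
  shows "\<exists>u v. has_split (monomial j) u v \<and> (\<forall>i\<ge>N. coeff u i = 0) \<and> (\<forall>i\<ge>N. coeff v i = 0)"
proof -
  \<comment> \<open>The monomials below z^(-N) come in pairs z^(-M), z^(M+1) with M < N.\<close>
  obtain M where M: "M < N" "j = - int M \<or> j = int M + 1"
  proof (cases "j > 0")
    case True
    with assms that[of "nat (j - 1)"] show ?thesis by (auto simp: monomial_less_nonpos)
  next
    case False
    with assms that[of "nat (- j)"] show ?thesis by (auto simp: monomial_less_nonpos)
  qed
  obtain f1 f2 where f: "\<And>z. z \<noteq> 0 \<Longrightarrow> z powi j = poly f1 (jacobi_var z) + z * poly f2 (jacobi_var z)"
      "\<And>i. i > M \<Longrightarrow> coeff f1 i = 0" "\<And>i. i > M \<Longrightarrow> coeff f2 i = 0"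
    using M(2) monomial_nonpos_decomp[of M] monomial_pos_decomp[of M] by (metis less_imp_le)
  show ?thesis
    by (rule exI[of _ "Polynomial.smult (1/2) (f1 - f2)"], rule exI[of _ "Polynomial.smult (1/2) (f1 + f2)"])
       (use f M(1) in \<open>auto simp: has_split_def field_simps\<close>)
qed

text \<open>The values at z and 1/z, which have the same t, give the two rows of \<open>Psi\<close>,
  and composing with (1 - x)/2 passes from t to x. Uniqueness holds because a polynomial is fixed by
  infinitely many values.\<close>

lemma vv_jacobi_eqI:
  assumes "\<forall>z. z \<noteq> 0 \<longrightarrow> laurent_eval (nonsym_jacobi n k) z = poly f1 (jacobi_var z) + z * poly f2 (jacobi_var z)"
  shows "vv_jacobi n k = vector [pcompose f1 [:1/2, -1/2:], pcompose f2 [:1/2, -1/2:]]"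
proof -
  let ?F = "vector [pcompose f1 [:1/2, -1/2:], pcompose f2 [:1/2, -1/2:]] :: complex poly^2"
  let ?sol = "\<lambda>F :: complex poly^2. \<forall>z. z \<noteq> 0 \<and> z\<^sup>2 \<noteq> 1 \<longrightarrow>
       (\<chi> i. poly (F $ i) ((z + inverse z) / 2)) = matrix_inv (Psi z) *v nonsym_jacobi_vec n k z"
  have sol: "?sol ?F"
  proof (intro allI impI)
    fix z :: complex assume z: "z \<noteq> 0 \<and> z\<^sup>2 \<noteq> 1"
    let ?w = "\<chi> i. poly (?F $ i) ((z + inverse z) / 2)"
    have "1 / 2 - (z + inverse z) / 4 = jacobi_var z"
      by (simp add: jacobi_var_def diff_divide_distrib add_divide_distrib)
    then have "poly (pcompose f [:1/2, -1/2:]) ((z + inverse z) / 2) = poly f (jacobi_var z)" for f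
      by (simp add: poly_pcompose)
    then have w: "?w $ 1 = poly f1 (jacobi_var z)" "?w $ 2 = poly f2 (jacobi_var z)" by simp_all
    have "jacobi_var (inverse z) = jacobi_var z" by (simp add: jacobi_var_def)
    then have "Psi z *v ?w = nonsym_jacobi_vec n k z"
      using assms[rule_format, of z] assms[rule_format, of "inverse z"] z w
      by (simp add: vec_eq_iff forall_2 Psi_def nonsym_jacobi_vec_def matrix_vector_mult_def sum_2)
    moreover have "invertible (Psi z)"
      using z by (auto simp: invertible_det_nz det_2 Psi_def field_simps power2_eq_square)
    then have "matrix_inv (Psi z) ** Psi z = mat 1"
      unfolding invertible_def matrix_inv_def by (rule someI2_ex) simp
    ultimately show "?w = matrix_inv (Psi z) *v nonsym_jacobi_vec n k z"
      by (metis matrix_vector_mul_assoc matrix_vector_mul_lid)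
  qed
  show ?thesis
    unfolding vv_jacobi_def
  proof (rule the_equality[of ?sol, OF sol])
    fix F assume F: "?sol F"
    \<comment> \<open>Real r between 1 and 2 avoid z = 0 and z^2 = 1, and r + 1/r is injective
      there.\<close>
    let ?X = "(\<lambda>r::real. complex_of_real ((r + inverse r) / 2)) ` {1<..<2}"
    have "inj_on (\<lambda>r::real. complex_of_real ((r + inverse r) / 2)) {1<..<2}"
    proof (rule inj_onI)
      fix r s :: real assume rs: "r \<in> {1<..<2}" "s \<in> {1<..<2}"
        "complex_of_real ((r + inverse r) / 2) = complex_of_real ((s + inverse s) / 2)"
      then have "r + inverse r = s + inverse s" by (simp only: of_real_eq_iff) simp
      then have "(r - s) * (r * s - 1) = 0" using rs(1,2) by (simp add: field_simps)
      moreover have "r * s > 1" using rs(1,2) by (simp add: less_1_mult)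
      ultimately show "r = s" by simp
    qed
    then have inf: "infinite ?X" by (simp add: finite_image_iff infinite_Ioo)
    show "F = ?F"
    proof (rule vec_eq_iff[THEN iffD2], rule allI, rule ccontr)
      fix i assume "F $ i \<noteq> ?F $ i"
      then have "finite {x. poly (F $ i - ?F $ i) x = 0}" by (intro poly_roots_finite) simp
      moreover have "?X \<subseteq> {x. poly (F $ i - ?F $ i) x = 0}"
      proof
        fix x assume "x \<in> ?X"
        then obtain r where r: "r \<in> {1<..<2}" "x = complex_of_real ((r + inverse r) / 2)" by blast
        have "r\<^sup>2 \<noteq> 1" using r(1) by (simp add: power2_eq_1_iff)
        then have z: "complex_of_real r \<noteq> 0 \<and> (complex_of_real r)\<^sup>2 \<noteq> 1"
          using r(1) by (simp flip: of_real_power)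
        have "(\<chi> i. poly (F $ i) ((of_real r + inverse (of_real r)) / 2))
            = (\<chi> i. poly (?F $ i) ((complex_of_real r + inverse (of_real r)) / 2))"
          using F[rule_format, OF z] sol[rule_format, OF z] by simp
        then show "x \<in> {x. poly (F $ i - ?F $ i) x = 0}"
          unfolding r(2) by (simp add: vec_eq_iff)
      qed
      ultimately show False using inf finite_subset by blast
    qed
  qed
qed

section \<open>Explicit formulas for E(-N) and E(N + 1)\<close>

context
  fixes k1 k2 \<alpha> \<beta> :: real
  assumes k: "k1 \<ge> 0" "k2 \<ge> 0" and \<alpha>: "\<alpha> = k1 + k2 - 1 / 2" and \<beta>: "\<beta> = k2 - 1 / 2"
begin

interpretation jacobi_functional "jacobi_integral (k1, k2)" "of_real (\<alpha> + 1)" "of_real (\<alpha> + \<beta> + 2)"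
  using jacobi_functional_integral[OF k] by (simp add: \<alpha> \<beta> algebra_simps)

text \<open>This separates the eigenvalues in \<open>orthogonal_lower_degree\<close> for the shifted
  value \<alpha> + \<beta> + 3 of \<open>s\<close>, common to both families.\<close>

lemma complex_shift_ne_0: "of_real (\<alpha> + \<beta> + 2) + 1 + of_nat j \<noteq> (0 :: complex)"
proof -
  have "\<alpha> + \<beta> + 2 + 1 + real j > 0" using k by (simp add: \<alpha> \<beta>)
  then have "complex_of_real (\<alpha> + \<beta> + 2 + 1 + real j) \<noteq> 0" by (metis less_irrefl of_real_eq_0_iff)
  then show ?thesis by simp
qed

text \<open>\<open>mult_t\<close> moves (c, s) to (\<alpha> + 2, \<alpha> + \<beta> + 3), the values
  in the differential equation for the parameters (\<alpha> + 1, \<beta>).\<close>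

lemma jacobi_poly_alpha_orthogonal:
  assumes "\<And>i. i \<ge> n \<Longrightarrow> coeff q i = 0"
  shows "jacobi_integral (k1, k2) ([:0, 1:] * (jacobi_poly n (\<alpha> + 1) \<beta> * q)) = 0"
proof -
  interpret T: jacobi_functional "\<lambda>p. jacobi_integral (k1, k2) ([:0, 1:] * p)"
      "of_real (\<alpha> + 1) + 1" "of_real (\<alpha> + \<beta> + 2) + 1" by (rule mult_t)
  have "\<alpha> + 1 > -1" using k by (simp add: \<alpha>)
  from jacobi_poly_ode[OF this, of \<beta> n] show ?thesis
    by (intro T.orthogonal_lower_degree[OF _ complex_shift_ne_0 assms]) (simp_all add: algebra_simps)
qed

lemma jacobi_poly_beta_orthogonal:
  assumes "\<And>i. i \<ge> n \<Longrightarrow> coeff q i = 0"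
  shows "jacobi_integral (k1, k2) ([:1, -1:] * (jacobi_poly n \<alpha> (\<beta> + 1) * q)) = 0"
proof -
  interpret T: jacobi_functional "\<lambda>p. jacobi_integral (k1, k2) ([:1, -1:] * p)"
      "of_real (\<alpha> + 1)" "of_real (\<alpha> + \<beta> + 2) + 1" by (rule mult_one_minus_t)
  have "\<alpha> > -1" using k by (simp add: \<alpha>)
  from jacobi_poly_ode[OF this, of "\<beta> + 1" n] show ?thesis
    by (intro T.orthogonal_lower_degree[OF _ complex_shift_ne_0 assms]) (simp_all add: algebra_simps)
qed

context
  fixes N :: nat and A \<kappa> :: complex and P Q :: "complex poly"
  defines "A \<equiv> of_real (2 powi (2 * int N - 1) * fact N / pochhammer (real N + \<alpha> + \<beta> + 2) N)"
    and "\<kappa> \<equiv> of_real ((\<alpha> - \<beta>) / (2 * real N + \<alpha> + \<beta> + 2))"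
    and "P \<equiv> jacobi_poly N (\<alpha> + 1) \<beta>" and "Q \<equiv> jacobi_poly N \<alpha> (\<beta> + 1)"
begin

text \<open>The second equation is the normalisation: t^N contributes (-1/4)^N, compensated by 4^N
  in \<open>A\<close> and the sign of the leading coefficient. The value is 1/2 because P and Q each
  supply half of the leading coefficient 1.\<close>

lemma lead_PQ: "coeff P N = coeff Q N" "A * coeff P N * (-1/4) ^ N = 1/2"
proof -
  have a: "\<alpha> > -1" "\<alpha> + 1 > -1" using k by (simp_all add: \<alpha>)
  have P: "coeff P N = of_real ((-1) ^ N * pochhammer (real N + \<alpha> + \<beta> + 2) N / fact N)"
    unfolding P_def coeff_jacobi_poly_lead[OF a(2)] by (simp add: algebra_simps)
  show "coeff P N = coeff Q N"
    unfolding P Q_def coeff_jacobi_poly_lead[OF a(1)] by (simp add: algebra_simps)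
  have pos: "pochhammer (real N + \<alpha> + \<beta> + 2) N > 0"
    using k by (intro pochhammer_pos) (simp add: \<alpha> \<beta>)
  have powi: "2 powi (2 * int N - 1) = (4 ^ N / 2 :: real)"
    by (simp add: power_int_diff power_int_mult)
  have pow: "4 ^ N * ((-1) ^ N * (-1/4) ^ N) = (1 :: real)"
    unfolding power_mult_distrib[symmetric] by simp
  have cancel: "X * fact N / B * ((-1) ^ N * B / fact N) * c = X * ((-1) ^ N * c)" if "B > 0" for X B c :: real
    using that by simp
  have "2 powi (2 * int N - 1) * fact N / pochhammer (real N + \<alpha> + \<beta> + 2) N
     * ((-1) ^ N * pochhammer (real N + \<alpha> + \<beta> + 2) N / fact N) * (-1/4) ^ N = 1/2"
    unfolding cancel[OF pos] powi using pow by simp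
  from arg_cong[OF this, of complex_of_real] show "A * coeff P N * (-1/4) ^ N = 1/2"
    unfolding A_def P of_real_mult of_real_power by simp
qed

text \<open>By \<open>norm_ratio\<close> the norms a of P and b of Q are as N + \<alpha> + 1 to N +
  \<beta> + 1, and \<kappa> is the resulting value of (a - b)/(a + b). This makes E(N + 1)
  orthogonal to z^(-N).\<close>

lemma kappa_norms:
  "(\<kappa> - 1) * jacobi_integral (k1, k2) ([:0, 1:] * (P * P))
     + (\<kappa> + 1) * jacobi_integral (k1, k2) ([:1, -1:] * (Q * Q)) = 0"
proof -
  let ?a = "jacobi_integral (k1, k2) ([:0, 1:] * (P * P))"
  let ?b = "jacobi_integral (k1, k2) ([:1, -1:] * (Q * Q))"
  define d where "d = complex_of_real (2 * real N + \<alpha> + \<beta> + 2)"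
  have "2 * real N + \<alpha> + \<beta> + 2 > 0" using k by (simp add: \<alpha> \<beta>)
  then have d: "d \<noteq> 0" unfolding d_def by (metis less_irrefl of_real_eq_0_iff)
  have ratio: "(of_nat N + of_real (\<alpha> + \<beta> + 2) - of_real (\<alpha> + 1)) * ?a = (of_nat N + of_real (\<alpha> + 1)) * ?b"
    by (rule norm_ratio[OF _ _ _ _ lead_PQ(1)]; unfold P_def Q_def)
      (rule jacobi_poly_alpha_orthogonal jacobi_poly_beta_orthogonal coeff_jacobi_poly_gt; simp)+
  have \<kappa>: "d * \<kappa> = of_real \<alpha> - of_real \<beta>"
    using d by (simp add: \<kappa>_def d_def)
  have "d * ((\<kappa> - 1) * a + (\<kappa> + 1) * b) = d * \<kappa> * (a + b) - d * (a - b)" for a b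
    by (simp add: algebra_simps)
  also have "d * \<kappa> * (a + b) - d * (a - b)
      = 2 * ((of_nat N + of_real (\<alpha> + 1)) * b - (of_nat N + of_real (\<alpha> + \<beta> + 2) - of_real (\<alpha> + 1)) * a)" for a b
    unfolding \<kappa> by (simp add: d_def algebra_simps)
  finally have expand: "d * ((\<kappa> - 1) * a + (\<kappa> + 1) * b)
      = 2 * ((of_nat N + of_real (\<alpha> + 1)) * b - (of_nat N + of_real (\<alpha> + \<beta> + 2) - of_real (\<alpha> + 1)) * a)" for a b .
  have "d * ((\<kappa> - 1) * ?a + (\<kappa> + 1) * ?b) = 0"
    unfolding expand ratio by simp
  then show ?thesis using d by simp
qed

lemma combination_inner:
  assumes E: "has_split E (Polynomial.smult (of_real a) P) (Polynomial.smult (of_real b) Q)"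
    and F: "has_split F u v"
  shows "laurent_inner (k1, k2) E F = 4 * (of_real a * jacobi_integral (k1, k2) ([:0, 1:] * (P * u))
     + of_real b * jacobi_integral (k1, k2) ([:1, -1:] * (Q * v)))"
proof -
  have "poly (Polynomial.smult (of_real a) P) (of_real y) \<in> \<real>" "poly (Polynomial.smult (of_real b) Q) (of_real y) \<in> \<real>" for y
    by (simp_all add: P_def Q_def poly_jacobi_poly_real)
  from laurent_inner_split[OF k E F this] show ?thesis
    by (simp only: mult_smult_left mult_smult_right smult)
qed

lemma combination_orthogonal_less:
  assumes E: "has_split E (Polynomial.smult (of_real a) P) (Polynomial.smult (of_real b) Q)"
    and j: "monomial_less j (- int N)"
  shows "laurent_inner (k1, k2) E (monomial j) = 0"
proof -
  obtain u v where uv: "has_split (monomial j) u v"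
      "\<And>i. i \<ge> N \<Longrightarrow> coeff u i = 0" "\<And>i. i \<ge> N \<Longrightarrow> coeff v i = 0"
    using monomial_split_less[OF j] by blast
  have "jacobi_integral (k1, k2) ([:0, 1:] * (P * u)) = 0" "jacobi_integral (k1, k2) ([:1, -1:] * (Q * v)) = 0"
    unfolding P_def Q_def using uv(2,3) by (intro jacobi_poly_alpha_orthogonal jacobi_poly_beta_orthogonal; simp)+
  then show ?thesis unfolding combination_inner[OF E uv(1)] by (simp only:) simp
qed

text \<open>E(-N) is A ((1 - z) P + (1 + z) Q). The leading coefficients of P and Q agree, so Q - P
  has degree below N, as \<open>laurent_with_leading_nonpos\<close> demands.\<close>

lemma nonsym_jacobi_nonpos:
  "\<forall>z. z \<noteq> 0 \<longrightarrow> laurent_eval (nonsym_jacobi (- int N) (k1, k2)) z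
    = poly (Polynomial.smult A (P + Q)) (jacobi_var z) + z * poly (Polynomial.smult A (Q - P)) (jacobi_var z)"
proof -
  obtain a where a: "A = of_real a" using A_def by blast
  have low: "coeff P i = 0" "coeff Q i = 0" if "i > N" for i
    using that by (simp_all add: P_def Q_def coeff_jacobi_poly_gt)
  obtain E where E: "\<And>z. z \<noteq> 0 \<Longrightarrow> laurent_eval E z
        = poly (Polynomial.smult A (P + Q)) (jacobi_var z) + z * poly (Polynomial.smult A (Q - P)) (jacobi_var z)"
      "Poly_Mapping.keys (E - monomial (- int N)) \<subseteq> {j. monomial_less j (- int N)}"
  proof (rule laurent_with_leading_nonpos)
    show "coeff (Polynomial.smult A (P + Q)) N * (-1/4) ^ N = 1"
      using lead_PQ by (simp add: algebra_simps)
    show "coeff (Polynomial.smult A (Q - P)) i = 0" if "i \<ge> N" for i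
      using that low lead_PQ(1) by (cases "i = N") auto
  qed (use low in auto)
  have "has_split E (Polynomial.smult (of_real a) P) (Polynomial.smult (of_real a) Q)"
    using E(1) by (simp add: has_split_def a algebra_simps)
  then have "nonsym_jacobi (- int N) (k1, k2) = E"
    by (intro nonsym_jacobi_eqI[OF k E(2)]) (simp add: combination_orthogonal_less)
  then show ?thesis using E(1) by simp
qed

text \<open>A Gram-Schmidt step: A ((1 + z) Q - (1 - z) P) has the right leading term and is
  orthogonal to all monomials below z^(-N). Adding \<kappa> E(-N) makes it orthogonal to z^(-N)
  too.\<close>

lemma nonsym_jacobi_pos:
  "\<forall>z. z \<noteq> 0 \<longrightarrow> laurent_eval (nonsym_jacobi (int N + 1) (k1, k2)) z
    = poly (Polynomial.smult A (Polynomial.smult \<kappa> (P + Q) + (Q - P))) (jacobi_var z)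
      + z * poly (Polynomial.smult A (Polynomial.smult \<kappa> (Q - P) + (P + Q))) (jacobi_var z)"
proof -
  \<comment> \<open>\<open>combination_inner\<close> is stated for real coefficients, so
    \<open>A\<close> and \<kappa> are exhibited as real.\<close>
  obtain A' \<kappa>' where r: "A = of_real A'" "\<kappa> = of_real \<kappa>'"
    unfolding A_def \<kappa>_def by blast
  define a where "a = A' * (\<kappa>' - 1)"
  define b where "b = A' * (\<kappa>' + 1)"
  have a: "A * (\<kappa> - 1) = of_real a" and b: "A * (\<kappa> + 1) = of_real b"
    by (simp_all add: r a_def b_def)
  have low: "coeff P i = 0" "coeff Q i = 0" if "i > N" for i
    using that by (simp_all add: P_def Q_def coeff_jacobi_poly_gt)
  obtain E where E: "\<And>z. z \<noteq> 0 \<Longrightarrow> laurent_eval E z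
        = poly (Polynomial.smult A (Polynomial.smult \<kappa> (P + Q) + (Q - P))) (jacobi_var z)
          + z * poly (Polynomial.smult A (Polynomial.smult \<kappa> (Q - P) + (P + Q))) (jacobi_var z)"
      "Poly_Mapping.keys (E - monomial (int N + 1)) \<subseteq> {j. monomial_less j (int N + 1)}"
  proof (rule laurent_with_leading_pos[of N "Polynomial.smult A (Polynomial.smult \<kappa> (P + Q) + (Q - P))"
        "Polynomial.smult A (Polynomial.smult \<kappa> (Q - P) + (P + Q))"])
    show "coeff (Polynomial.smult A (Polynomial.smult \<kappa> (Q - P) + (P + Q))) N * (-1/4) ^ N = 1"
      using lead_PQ by (simp add: algebra_simps)
  qed (use low in auto)
  have E': "has_split E (Polynomial.smult (of_real a) P) (Polynomial.smult (of_real b) Q)"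
    using E(1) by (simp add: has_split_def a[symmetric] b[symmetric] algebra_simps)
  have "laurent_inner (k1, k2) E (monomial j) = 0" if "monomial_less j (int N + 1)" for j
  proof (cases "j = - int N")
    case False
    with that have "monomial_less j (- int N)"
      unfolding monomial_less_pos monomial_less_nonpos by linarith
    then show ?thesis using combination_orthogonal_less[OF E'] by simp
  next
    case True
    obtain u v where uv: "has_split (monomial j) u v"
        "\<And>i. i > N \<Longrightarrow> coeff u i = 0" "\<And>i. i > N \<Longrightarrow> coeff v i = 0" "coeff u N = coeff v N"
      using monomial_split_le[of N] True by blast
    interpret T1: jacobi_functional "\<lambda>p. jacobi_integral (k1, k2) ([:0, 1:] * p)"
      "of_real (\<alpha> + 1) + 1" "of_real (\<alpha> + \<beta> + 2) + 1" by (rule mult_t)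
    interpret T2: jacobi_functional "\<lambda>p. jacobi_integral (k1, k2) ([:1, -1:] * p)"
      "of_real (\<alpha> + 1)" "of_real (\<alpha> + \<beta> + 2) + 1" by (rule mult_one_minus_t)
    have 1: "coeff P N * jacobi_integral (k1, k2) ([:0, 1:] * (P * u))
        = coeff u N * jacobi_integral (k1, k2) ([:0, 1:] * (P * P))"
      by (rule T1.orthogonal_leading_coeff)
         (use low(1) uv(2) in \<open>auto intro: jacobi_poly_alpha_orthogonal simp only: P_def\<close>)
    have 2: "coeff P N * jacobi_integral (k1, k2) ([:1, -1:] * (Q * v))
        = coeff u N * jacobi_integral (k1, k2) ([:1, -1:] * (Q * Q))"
      unfolding lead_PQ(1) uv(4)
      by (rule T2.orthogonal_leading_coeff)
         (use low(2) uv(3) in \<open>auto intro: jacobi_poly_beta_orthogonal simp only: Q_def\<close>)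
    have field_identity: "p * (4 * (A * (\<kappa> - 1) * y + A * (\<kappa> + 1) * z))
        = 4 * A * ((\<kappa> - 1) * (p * y) + (\<kappa> + 1) * (p * z))" for p y z
      by (simp add: algebra_simps)
    have field_identity': "4 * A * ((\<kappa> - 1) * (p * y) + (\<kappa> + 1) * (p * z))
        = 4 * A * p * ((\<kappa> - 1) * y + (\<kappa> + 1) * z)" for p y z
      by (simp add: algebra_simps)
    \<comment> \<open>The factor \<open>coeff P N\<close>, nonzero by \<open>lead_PQ(2)\<close>,
      lets \<open>1\<close> and \<open>2\<close> turn both integrals into norms with the common
      factor \<open>coeff u N\<close>.\<close>
    have "coeff P N * laurent_inner (k1, k2) E (monomial j)
      = 4 * A * ((\<kappa> - 1) * (coeff P N * jacobi_integral (k1, k2) ([:0, 1:] * (P * u)))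
         + (\<kappa> + 1) * (coeff P N * jacobi_integral (k1, k2) ([:1, -1:] * (Q * v))))"
      unfolding combination_inner[OF E' uv(1)] a[symmetric] b[symmetric]
      by (rule field_identity)
    also have "\<dots> = 4 * A * coeff u N * ((\<kappa> - 1) * jacobi_integral (k1, k2) ([:0, 1:] * (P * P))
         + (\<kappa> + 1) * jacobi_integral (k1, k2) ([:1, -1:] * (Q * Q)))"
      unfolding 1 2 by (rule field_identity')
    also have "\<dots> = 0" unfolding kappa_norms by simp
    finally show ?thesis using lead_PQ(2) by auto
  qed
  then have "nonsym_jacobi (int N + 1) (k1, k2) = E"
    by (intro nonsym_jacobi_eqI[OF k E(2)]) simp
  then show ?thesis using E(1) by simp
qed

end

end

theorem proposition2p5:
  fixes N :: nat and k1 k2 \<alpha> \<beta> :: real and x :: complex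
  assumes "k1 \<ge> 0" and "k2 \<ge> 0"
    and "\<alpha> = k1 + k2 - 1 / 2" and "\<beta> = k2 - 1 / 2"
  shows "poly_matrix_eval (mv_jacobi N (k1, k2)) x =
    (2 powi (2 * int N - 1) * fact N / pochhammer (real N + \<alpha> + \<beta> + 2) N) *\<^sub>R
    ((vector
        [vector [  jacobi_P N (\<alpha> + 1) \<beta> x + jacobi_P N \<alpha> (\<beta> + 1) x,
                 - jacobi_P N (\<alpha> + 1) \<beta> x + jacobi_P N \<alpha> (\<beta> + 1) x],
         vector [- jacobi_P N (\<alpha> + 1) \<beta> x + jacobi_P N \<alpha> (\<beta> + 1) x,
                   jacobi_P N (\<alpha> + 1) \<beta> x + jacobi_P N \<alpha> (\<beta> + 1) x]] :: complex^2^2) **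
     vector
        [vector [1, of_real ((\<alpha> - \<beta>) / (2 * real N + \<alpha> + \<beta> + 2))],
         vector [0, 1]])"
proof -
  define a where "a = 2 powi (2 * int N - 1) * fact N / pochhammer (real N + \<alpha> + \<beta> + 2) N"
  define \<kappa> where "\<kappa> = complex_of_real ((\<alpha> - \<beta>) / (2 * real N + \<alpha> + \<beta> + 2))"
  define P where "P = jacobi_poly N (\<alpha> + 1) \<beta>"
  define Q where "Q = jacobi_poly N \<alpha> (\<beta> + 1)"
  have x: "1 / 2 - x / 2 = (1 - x) / 2" by (simp add: diff_divide_distrib)
  \<comment> \<open>The second column is A (Q - P, P + Q) plus \<kappa> times the first, which is
    the product with the unipotent matrix.\<close>
  note col1 = vv_jacobi_eqI[OF nonsym_jacobi_nonpos[OF assms]]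
  note col2 = vv_jacobi_eqI[OF nonsym_jacobi_pos[OF assms]]
  show ?thesis
    unfolding poly_matrix_eval_def mv_jacobi_def jacobi_P_eq_poly a_def[symmetric] \<kappa>_def[symmetric]
      col1[of N, folded a_def \<kappa>_def P_def Q_def] col2[of N, folded a_def \<kappa>_def P_def Q_def]
      P_def[symmetric] Q_def[symmetric]
    by (simp add: vec_eq_iff forall_2 matrix_matrix_mult_def sum_2 poly_pcompose x)
       (simp add: scaleR_conv_of_real algebra_simps)
qed

end
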